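(* Let $R$ be an alternative ring (not necessarily with $1$) which is not associative. Assume that no non-zero associator $(x,y,z)$, $x,y,z\in R$, is a zero divisor in $R$. Then: (a) $R$ contains no zero divisors. (b) If, in addition, the characteristic of $R$ is not $2$, then the central quotient ring $R//C$ is an $8$-dimensional octonion division algebra over its center, and this center is the fraction field of the center $C$ of $R$.
   Context: Rings are not assumed to be associative, nor to have an identity element. For $x,y,z$ in a ring $R$, the associator is $(x,y,z)=(xy)z-x(yz)$ and the commutator is $(x,y)=xy-yx$. The ring $R$ is alternative if $(x,y,y)=0=(y,y,x)$ for all $x,y\in R$. The nucleus of an alternative ring $R$ is $N=\{n\in R\mid (n,y,z)=0 \text{ for all } y,z\in R\}$; in an alternative ring the associator is skew-symmetric in its three variables, so $(y,n,z)=(y,z,n)=0$ also holds for $n\in N$. The center of $R$ is $C=\{c\in N\mid (c,x)=0\text{ for all }x\in R\}$. Zero divisors: a non-zero element $x\in R$ is a left zero divisor if there is a non-zero $y\in R$ with $xy=0$, and a right zero divisor if there is a non-zero $y\in R$ with $yx=0$. A non-zero element is a zero divisor if it is a left zero divisor or a right zero divisor. Thus "not a zero divisor" means neither a left nor a right zero divisor. Characteristic: "the characteristic of $R$ is not $2$" means that $2x\neq 0$ for some $x\in R$; when $R$ has no zero divisors (as in part (a)), this is equivalent to $2x\ne 0$ for every non-zero $x\in R$. Central quotient: $R//C$ denotes the ring of fractions of $R$ with respect to the non-zero elements of $C$, i.e. the set of equivalence classes $r/c$ of pairs $(r,c)$ with $r\in R$, $0\neq c\in C$, where $(r,c)\sim(r',c')$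 if and only if $rc'=r'c$, with $r/c+r'/c'=(rc'+r'c)/(cc')$ and $(r/c)(r'/c')=(rr')/(cc')$. (The assertion in (b) includes that this makes sense, i.e. that $C\neq 0$.) The fraction field of $C$ is identified with the set of classes $d/c$ with $d,c\in C$, $c\ne 0$. An octonion algebra over a field $F$ is an $8$-dimensional unital (not necessarily associative) $F$-algebra $A$ with a quadratic form $q$, whose associated bilinear form is non-degenerate, such that $q(ab)=q(a)q(b)$ for all $a,b\in A$; it is a division algebra if every non-zero element is invertible (equivalently, $A$ has no zero divisors). The center of $A$ is defined as for rings above. *)

theory Defs
  imports "HOL-Algebra.Ring" "Jordan_Normal_Form.Missing_VectorSpace"
begin

section \<open>Nonassociative and alternative rings\<close>

text \<open>
  Rings are not assumed to be associative or unital. We reuse the record type of HOL-Algebra;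
  in \<open>nonassoc_ring\<close> and \<open>alternative_ring\<close> its field \<open>one\<close> is unconstrained and never used.
\<close>

locale nonassoc_ring = abelian_group R for R (structure) +
  assumes na_m_closed: "\<lbrakk>x \<in> carrier R; y \<in> carrier R\<rbrakk> \<Longrightarrow> x \<otimes> y \<in> carrier R"
    and na_l_distr: "\<lbrakk>x \<in> carrier R; y \<in> carrier R; z \<in> carrier R\<rbrakk>
      \<Longrightarrow> (x \<oplus> y) \<otimes> z = x \<otimes> z \<oplus> y \<otimes> z"
    and na_r_distr: "\<lbrakk>x \<in> carrier R; y \<in> carrier R; z \<in> carrier R\<rbrakk>
      \<Longrightarrow> z \<otimes> (x \<oplus> y) = z \<otimes> x \<oplus> z \<otimes> y"

definition associator :: "('a, 'm) ring_scheme \<Rightarrow> 'a \<Rightarrow> 'a \<Rightarrow> 'a \<Rightarrow> 'a" where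
  "associator R x y z = (x \<otimes>\<^bsub>R\<^esub> y) \<otimes>\<^bsub>R\<^esub> z \<ominus>\<^bsub>R\<^esub> x \<otimes>\<^bsub>R\<^esub> (y \<otimes>\<^bsub>R\<^esub> z)"

definition commutator :: "('a, 'm) ring_scheme \<Rightarrow> 'a \<Rightarrow> 'a \<Rightarrow> 'a" where
  "commutator R x y = x \<otimes>\<^bsub>R\<^esub> y \<ominus>\<^bsub>R\<^esub> y \<otimes>\<^bsub>R\<^esub> x"

locale alternative_ring = nonassoc_ring R for R (structure) +
  assumes right_alternative: "\<lbrakk>x \<in> carrier R; y \<in> carrier R\<rbrakk> \<Longrightarrow> associator R x y y = \<zero>"
    and left_alternative: "\<lbrakk>x \<in> carrier R; y \<in> carrier R\<rbrakk> \<Longrightarrow> associator R y y x = \<zero>"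

definition associative_ring :: "('a, 'm) ring_scheme \<Rightarrow> bool" where
  "associative_ring R \<longleftrightarrow>
     (\<forall>x\<in>carrier R. \<forall>y\<in>carrier R. \<forall>z\<in>carrier R. associator R x y z = \<zero>\<^bsub>R\<^esub>)"

definition nucleus :: "('a, 'm) ring_scheme \<Rightarrow> 'a set" where
  "nucleus R = {n \<in> carrier R. \<forall>y\<in>carrier R. \<forall>z\<in>carrier R. associator R n y z = \<zero>\<^bsub>R\<^esub>}"

definition ring_center :: "('a, 'm) ring_scheme \<Rightarrow> 'a set" where
  "ring_center R = {c \<in> nucleus R. \<forall>x\<in>carrier R. commutator R c x = \<zero>\<^bsub>R\<^esub>}"

definition left_zero_divisor :: "('a, 'm) ring_scheme \<Rightarrow> 'a \<Rightarrow> bool" where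
  "left_zero_divisor R x \<longleftrightarrow>
     x \<in> carrier R - {\<zero>\<^bsub>R\<^esub>} \<and> (\<exists>y\<in>carrier R - {\<zero>\<^bsub>R\<^esub>}. x \<otimes>\<^bsub>R\<^esub> y = \<zero>\<^bsub>R\<^esub>)"

definition right_zero_divisor :: "('a, 'm) ring_scheme \<Rightarrow> 'a \<Rightarrow> bool" where
  "right_zero_divisor R x \<longleftrightarrow>
     x \<in> carrier R - {\<zero>\<^bsub>R\<^esub>} \<and> (\<exists>y\<in>carrier R - {\<zero>\<^bsub>R\<^esub>}. y \<otimes>\<^bsub>R\<^esub> x = \<zero>\<^bsub>R\<^esub>)"

definition zero_divisor :: "('a, 'm) ring_scheme \<Rightarrow> 'a \<Rightarrow> bool" where
  "zero_divisor R x \<longleftrightarrow> left_zero_divisor R x \<or> right_zero_divisor R x"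


section \<open>Central quotients\<close>

definition frac_pairs :: "('a, 'm) ring_scheme \<Rightarrow> ('a \<times> 'a) set" where
  "frac_pairs R = carrier R \<times> (ring_center R - {\<zero>\<^bsub>R\<^esub>})"

definition frac_rel :: "('a, 'm) ring_scheme \<Rightarrow> (('a \<times> 'a) \<times> ('a \<times> 'a)) set" where
  "frac_rel R = {((r, c), (r', c')). (r, c) \<in> frac_pairs R \<and> (r', c') \<in> frac_pairs R
     \<and> r \<otimes>\<^bsub>R\<^esub> c' = r' \<otimes>\<^bsub>R\<^esub> c}"

definition frac_class :: "('a, 'm) ring_scheme \<Rightarrow> 'a \<times> 'a \<Rightarrow> ('a \<times> 'a) set" where
  "frac_class R p = frac_rel R `` {p}"

definition pair_add :: "('a, 'm) ring_scheme \<Rightarrow> 'a \<times> 'a \<Rightarrow> 'a \<times> 'a \<Rightarrow> 'a \<times> 'a" where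
  "pair_add R p p' =
     (fst p \<otimes>\<^bsub>R\<^esub> snd p' \<oplus>\<^bsub>R\<^esub> fst p' \<otimes>\<^bsub>R\<^esub> snd p, snd p \<otimes>\<^bsub>R\<^esub> snd p')"

definition pair_mult :: "('a, 'm) ring_scheme \<Rightarrow> 'a \<times> 'a \<Rightarrow> 'a \<times> 'a \<Rightarrow> 'a \<times> 'a" where
  "pair_mult R p p' = (fst p \<otimes>\<^bsub>R\<^esub> fst p', snd p \<otimes>\<^bsub>R\<^esub> snd p')"

text \<open>
  The operations on classes are unions over all representatives (as in \<open>UN_equiv_class2\<close>); they
  give the expected classes as soon as \<open>central_quotient_makes_sense\<close> below holds.
  The zero is \<open>0/c\<close> and the identity \<open>c/c\<close>, for any non-zero central \<open>c\<close>.
\<close>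

definition central_quotient :: "('a, 'm) ring_scheme \<Rightarrow> ('a \<times> 'a) set ring" where
  "central_quotient R =
    \<lparr> carrier = frac_pairs R // frac_rel R,
      mult = (\<lambda>X Y. \<Union>p\<in>X. \<Union>p'\<in>Y. frac_class R (pair_mult R p p')),
      one = (\<Union>c\<in>ring_center R - {\<zero>\<^bsub>R\<^esub>}. frac_class R (c, c)),
      zero = (\<Union>c\<in>ring_center R - {\<zero>\<^bsub>R\<^esub>}. frac_class R (\<zero>\<^bsub>R\<^esub>, c)),
      add = (\<lambda>X Y. \<Union>p\<in>X. \<Union>p'\<in>Y. frac_class R (pair_add R p p')) \<rparr>"

text \<open>
  There is a non-zero denominator, \<open>frac_rel\<close> is an equivalence relation, and the operations on
  pairs respect it (in particular, \<open>c \<otimes> c'\<close> is again a non-zero central element).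
\<close>

definition central_quotient_makes_sense :: "('a, 'm) ring_scheme \<Rightarrow> bool" where
  "central_quotient_makes_sense R \<longleftrightarrow>
     ring_center R \<noteq> {\<zero>\<^bsub>R\<^esub>} \<and>
     equiv (frac_pairs R) (frac_rel R) \<and>
     (\<forall>(p1, p2)\<in>frac_rel R. \<forall>(p1', p2')\<in>frac_rel R.
        (pair_add R p1 p1', pair_add R p2 p2') \<in> frac_rel R \<and>
        (pair_mult R p1 p1', pair_mult R p2 p2') \<in> frac_rel R)"


section \<open>Octonion algebras\<close>

locale unital_algebra = vectorspace F A + nonassoc_ring A
  for F (structure) and A (structure) +
  assumes unit_closed: "\<one>\<^bsub>A\<^esub> \<in> carrier A"
    and unit_left: "x \<in> carrier A \<Longrightarrow> \<one>\<^bsub>A\<^esub> \<otimes>\<^bsub>A\<^esub> x = x"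
    and unit_right: "x \<in> carrier A \<Longrightarrow> x \<otimes>\<^bsub>A\<^esub> \<one>\<^bsub>A\<^esub> = x"
    and smult_left: "\<lbrakk>a \<in> carrier F; x \<in> carrier A; y \<in> carrier A\<rbrakk>
      \<Longrightarrow> (a \<odot>\<^bsub>A\<^esub> x) \<otimes>\<^bsub>A\<^esub> y = a \<odot>\<^bsub>A\<^esub> (x \<otimes>\<^bsub>A\<^esub> y)"
    and smult_right: "\<lbrakk>a \<in> carrier F; x \<in> carrier A; y \<in> carrier A\<rbrakk>
      \<Longrightarrow> x \<otimes>\<^bsub>A\<^esub> (a \<odot>\<^bsub>A\<^esub> y) = a \<odot>\<^bsub>A\<^esub> (x \<otimes>\<^bsub>A\<^esub> y)"

definition polar_form ::
  "('k, 'm) ring_scheme \<Rightarrow> ('k, 'v, 'n) module_scheme \<Rightarrow> ('v \<Rightarrow> 'k) \<Rightarrow> 'v \<Rightarrow> 'v \<Rightarrow> 'k" where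
  "polar_form F V q x y = q (x \<oplus>\<^bsub>V\<^esub> y) \<ominus>\<^bsub>F\<^esub> q x \<ominus>\<^bsub>F\<^esub> q y"

text \<open>Linearity of the polar form in one argument suffices, since it is symmetric.\<close>

definition quadratic_form ::
  "('k, 'm) ring_scheme \<Rightarrow> ('k, 'v, 'n) module_scheme \<Rightarrow> ('v \<Rightarrow> 'k) \<Rightarrow> bool" where
  "quadratic_form F V q \<longleftrightarrow>
     q \<in> carrier V \<rightarrow> carrier F \<and>
     (\<forall>a\<in>carrier F. \<forall>x\<in>carrier V. q (a \<odot>\<^bsub>V\<^esub> x) = (a \<otimes>\<^bsub>F\<^esub> a) \<otimes>\<^bsub>F\<^esub> q x) \<and>
     (\<forall>x\<in>carrier V. \<forall>y\<in>carrier V. \<forall>z\<in>carrier V.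
        polar_form F V q (x \<oplus>\<^bsub>V\<^esub> y) z = polar_form F V q x z \<oplus>\<^bsub>F\<^esub> polar_form F V q y z) \<and>
     (\<forall>a\<in>carrier F. \<forall>x\<in>carrier V. \<forall>y\<in>carrier V.
        polar_form F V q (a \<odot>\<^bsub>V\<^esub> x) y = a \<otimes>\<^bsub>F\<^esub> polar_form F V q x y)"

definition nondegenerate_form ::
  "('k, 'm) ring_scheme \<Rightarrow> ('k, 'v, 'n) module_scheme \<Rightarrow> ('v \<Rightarrow> 'v \<Rightarrow> 'k) \<Rightarrow> bool" where
  "nondegenerate_form F V b \<longleftrightarrow>
     (\<forall>x\<in>carrier V. (\<forall>y\<in>carrier V. b x y = \<zero>\<^bsub>F\<^esub>) \<longrightarrow> x = \<zero>\<^bsub>V\<^esub>)"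

definition octonion_algebra ::
  "('k, 'm) ring_scheme \<Rightarrow> ('k, 'v, 'n) module_scheme \<Rightarrow> bool" where
  "octonion_algebra F A \<longleftrightarrow>
     unital_algebra F A \<and> vectorspace.fin_dim F A \<and> vectorspace.dim F A = 8 \<and>
     (\<exists>q. quadratic_form F A q \<and> nondegenerate_form F A (polar_form F A q) \<and>
        (\<forall>x\<in>carrier A. \<forall>y\<in>carrier A. q (x \<otimes>\<^bsub>A\<^esub> y) = q x \<otimes>\<^bsub>F\<^esub> q y))"

definition octonion_division_algebra ::
  "('k, 'm) ring_scheme \<Rightarrow> ('k, 'v, 'n) module_scheme \<Rightarrow> bool" where
  "octonion_division_algebra F A \<longleftrightarrow>
     octonion_algebra F A \<and>
     (\<forall>x\<in>carrier A - {\<zero>\<^bsub>A\<^esub>}. \<exists>y\<in>carrier A. x \<otimes>\<^bsub>A\<^esub> y = \<one>\<^bsub>A\<^esub> \<and> y \<otimes>\<^bsub>A\<^esub> x = \<one>\<^bsub>A\<^esub>)"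

text \<open>A ring as a module over a subset of itself: scalars act by left multiplication.\<close>

definition self_module :: "'a ring \<Rightarrow> ('a, 'a) module" where
  "self_module Q =
    \<lparr> carrier = carrier Q, mult = mult Q, one = one Q, zero = zero Q, add = add Q,
      smult = mult Q \<rparr>"

definition center_ring :: "'a ring \<Rightarrow> 'a ring" where
  "center_ring Q = Q \<lparr> carrier := ring_center Q \<rparr>"

end

theory Submission
  imports Defs
begin

text \<open>
  Kleinfeld's function, an alternating function of four arguments that measures the failure of a product rule for
  associators, makes \<open>A z = \<langle>x, y, z\<rangle>\<close> an operator exchanging left and right multiplication by \<open>x\<close> and
  \<open>y\<close>, and implies that the commutator \<open>v\<close> of \<open>x\<close> and \<open>y\<close> anticommutes with all \<open>A z\<close>
  (\<open>associator_iterate\<close>). When nonzero associators are not zero divisors, elements with product zero turn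
  out to be nuclear, while nuclear elements cannot be zero divisors
  (\<open>regular_associators_no_zero_divisors\<close>).

  In a domain that is not associative, \<open>v * v\<close> lies in the nucleus whenever \<open>A \<noteq> 0\<close> (\<open>commutator_square_nuclear\<close>), and the nucleus
  is the center (\<open>nuclear_imp_central\<close>). In characteristic other than 2, the squares of \<open>v\<close>, of \<open>x * v\<close> and of
  their sum or difference give every noncentral \<open>x\<close> a quadratic equation over the center
  (\<open>quadratic_equation\<close>). In particular the center is not zero, so the central quotient exists; it is a
  domain of the same kind whose center is the fraction field of the original one. There the
  quadratic equations split every element into a central and a pure part, and the resulting conjugation
  is an anti-automorphism, which makes the norm form multiplicative.

  Orthogonalizing the entries of a nonzero associator produces a Cayley-Dickson basis of eight elements. An
  element orthogonal to all of them would allow a fourth doubling, which fails to be alternative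
  (\<open>octonion_basis\<close>).

  The algebra is done in type classes and reaches rings on a carrier set through a type whose elements are
  those of a hypothetical counterexample (\<open>alternative_structure\<close>).
\<close>

section \<open>Nonassociative rings on types\<close>

class na_ring = ab_group_add + times +
  assumes dist_r: "(x + y) * z = x * z + y * z"
    and dist_l: "z * (x + y) = z * x + z * y"

class alt_ring = na_ring +
  assumes alt_r: "(x * y) * y = x * (y * y)"
    and alt_l: "(y * y) * x = y * (y * x)"

lemma zero_mult [simp]: "0 * x = (0 :: 'a :: na_ring)"
  using dist_r[of 0 0 x] by simp

lemma mult_zero [simp]: "x * 0 = (0 :: 'a :: na_ring)"
  using dist_l[of x 0 0] by simp

lemma neg_mult: "- x * y = - (x * y)" for x y :: "'a :: na_ring"
  using dist_r[of x "- x" y] by (simp add: eq_neg_iff_add_eq_0 add.commute)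

lemma mult_neg: "x * - y = - (x * y)" for x y :: "'a :: na_ring"
  using dist_l[of x y "- y"] by (simp add: eq_neg_iff_add_eq_0 add.commute)

lemma diff_dist_r: "(x - y) * z = x * z - y * z" for x y z :: "'a :: na_ring"
  using dist_r[of x "- y" z] by (simp add: neg_mult)

lemma diff_dist_l: "z * (x - y) = z * x - z * y" for x y z :: "'a :: na_ring"
  using dist_l[of z x "- y"] by (simp add: mult_neg)

lemmas dist = dist_r dist_l diff_dist_r diff_dist_l neg_mult mult_neg

text \<open>
  The algebra takes place on types, where addition and its cancellation laws come with full
  automation; the passage to rings given by a carrier set is made once, at the end.
\<close>

definition type_associator :: "'a :: na_ring \<Rightarrow> 'a \<Rightarrow> 'a \<Rightarrow> 'a"  ("\<langle>_,/ _,/ _\<rangle>")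
  where "\<langle>x, y, z\<rangle> = (x * y) * z - x * (y * z)"

definition type_commutator :: "'a :: na_ring \<Rightarrow> 'a \<Rightarrow> 'a"  ("\<lbrace>_,/ _\<rbrace>")
  where "\<lbrace>x, y\<rbrace> = x * y - y * x"

lemma associator_add:
  "\<langle>x + x', y, z\<rangle> = \<langle>x, y, z\<rangle> + \<langle>x', y, z\<rangle>"
  "\<langle>x, y + y', z\<rangle> = \<langle>x, y, z\<rangle> + \<langle>x, y', z\<rangle>"
  "\<langle>x, y, z + z'\<rangle> = \<langle>x, y, z\<rangle> + \<langle>x, y, z'\<rangle>"
  by (simp_all add: type_associator_def dist algebra_simps)

lemma associator_neg:
  "\<langle>- x, y, z\<rangle> = - \<langle>x, y, z\<rangle>" "\<langle>x, - y, z\<rangle> = - \<langle>x, y, z\<rangle>" "\<langle>x, y, - z\<rangle> = - \<langle>x, y, z\<rangle>"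
  by (simp_all add: type_associator_def dist)

lemma associator_diff:
  "\<langle>x - x', y, z\<rangle> = \<langle>x, y, z\<rangle> - \<langle>x', y, z\<rangle>"
  "\<langle>x, y - y', z\<rangle> = \<langle>x, y, z\<rangle> - \<langle>x, y', z\<rangle>"
  "\<langle>x, y, z - z'\<rangle> = \<langle>x, y, z\<rangle> - \<langle>x, y, z'\<rangle>"
  by (simp_all add: type_associator_def dist algebra_simps)

lemma associator_zero [simp]: "\<langle>0, y, z\<rangle> = 0" "\<langle>x, 0, z\<rangle> = 0" "\<langle>x, y, 0\<rangle> = 0"
  by (simp_all add: type_associator_def)

lemmas associator_lin = associator_add associator_diff associator_neg

lemma teichmueller:
  "\<langle>w * x, y, z\<rangle> - \<langle>w, x * y, z\<rangle> + \<langle>w, x, y * z\<rangle> = w * \<langle>x, y, z\<rangle> + \<langle>w, x, y\<rangle> * z"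
  by (simp add: type_associator_def dist algebra_simps)

lemma associator_same [simp]: "\<langle>x, x, y\<rangle> = 0" "\<langle>x, y, y\<rangle> = 0" for x y :: "'a :: alt_ring"
  by (simp_all add: type_associator_def alt_r alt_l)

lemma associator_swap12: "\<langle>y, x, z\<rangle> = - \<langle>x, y, z\<rangle>" for x y z :: "'a :: alt_ring"
  using associator_same(1)[of "x + y" z] associator_same(1)[of x z] associator_same(1)[of y z]
  unfolding associator_add by (simp add: eq_neg_iff_add_eq_0)

lemma associator_swap23: "\<langle>x, z, y\<rangle> = - \<langle>x, y, z\<rangle>" for x y z :: "'a :: alt_ring"
  using associator_same(2)[of x "y + z"] associator_same(2)[of x y] associator_same(2)[of x z]
  unfolding associator_add by (simp add: eq_neg_iff_add_eq_0)

lemma associator_cyc: "\<langle>x, y, z\<rangle> = \<langle>y, z, x\<rangle>" for x y z :: "'a :: alt_ring"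
  by (metis associator_swap12 associator_swap23 minus_minus)

lemma associator_same' [simp]: "\<langle>x, y, x\<rangle> = 0" for x y :: "'a :: alt_ring"
  using associator_swap23[of x y x] by simp

lemma flexible: "(x * y) * x = x * (y * x)" for x y :: "'a :: alt_ring"
  using associator_same'[of x y] unfolding type_associator_def by simp

section \<open>The Kleinfeld function\<close>

text \<open>
  The defect of the product rule \<open>\<langle>w * x, y, z\<rangle> = x * \<langle>w, y, z\<rangle> + \<langle>x, y, z\<rangle> * w\<close>, introduced by Kleinfeld. It is
  alternating in its four arguments in every characteristic, and this single fact is the source of all
  product rules for associators below.
\<close>

definition kleinfeld :: "'a :: alt_ring \<Rightarrow> 'a \<Rightarrow> 'a \<Rightarrow> 'a \<Rightarrow> 'a"
  where "kleinfeld w x y z = \<langle>w * x, y, z\<rangle> - x * \<langle>w, y, z\<rangle> - \<langle>x, y, z\<rangle> * w"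

lemma kleinfeld_swap34: "kleinfeld w x z y = - kleinfeld w x y z"
  unfolding kleinfeld_def
  by (simp add: associator_swap23[of _ z y] dist algebra_simps)

text \<open>
  The Teichmueller identity, rewritten with cyclic associators so that its three associators of
  products become the leading terms of three values of Kleinfeld's function.
\<close>

lemma kleinfeld_alternating_sum:
  "kleinfeld w x y z - kleinfeld x y z w + kleinfeld y z w x =
   \<lbrace>w, \<langle>x, y, z\<rangle>\<rbrace> - \<lbrace>x, \<langle>y, z, w\<rangle>\<rbrace> + \<lbrace>y, \<langle>z, w, x\<rangle>\<rbrace> - \<lbrace>z, \<langle>w, x, y\<rangle>\<rbrace>"
proof -
  have 1: "\<langle>w * x, y, z\<rangle> = \<langle>x * y, z, w\<rangle> - \<langle>y * z, w, x\<rangle> + w * \<langle>x, y, z\<rangle> + \<langle>w, x, y\<rangle> * z"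
    using teichmueller[of w x y z] associator_cyc[of w "x * y" z] associator_cyc[of w x "y * z"]
      associator_cyc[of x "y * z" w]
    by (simp add: algebra_simps)
  have 2: "\<langle>x, z, w\<rangle> = \<langle>z, w, x\<rangle>" "\<langle>w, y, z\<rangle> = \<langle>y, z, w\<rangle>" "\<langle>y, w, x\<rangle> = \<langle>w, x, y\<rangle>"
    by (metis associator_cyc)+
  show ?thesis
    unfolding kleinfeld_def type_commutator_def 2 1 by (simp add: algebra_simps)
qed

text \<open>
  The right-hand side of the previous identity changes sign under a cyclic shift of its arguments.
  Adding the identity to its shifted version cancels all but two of the six values on the left.
\<close>

lemma kleinfeld_cyc: "kleinfeld x y z w = - kleinfeld w x y z"
proof -
  let ?S = "\<lambda>w x y z. \<lbrace>w, \<langle>x, y, z\<rangle>\<rbrace> - \<lbrace>x, \<langle>y, z, w\<rangle>\<rbrace> + \<lbrace>y, \<langle>z, w, x\<rangle>\<rbrace> - \<lbrace>z, \<langle>w, x, y\<rangle>\<rbrace>"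
  have *: "kleinfeld z w x y = - kleinfeld w x y z" for w x y z
  proof -
    have "?S w x y z = - ?S x y z w"
      by (simp add: algebra_simps)
    with kleinfeld_alternating_sum[of w x y z] kleinfeld_alternating_sum[of x y z w]
    have "kleinfeld w x y z - kleinfeld x y z w + kleinfeld y z w x =
      - (kleinfeld x y z w - kleinfeld y z w x + kleinfeld z w x y)" by simp
    then have "kleinfeld w x y z + kleinfeld z w x y = 0"
      by (simp add: algebra_simps)
    then show ?thesis
      by (simp add: eq_neg_iff_add_eq_0 add.commute)
  qed
  show ?thesis
    using *[of w x y z] by simp
qed

lemma kleinfeld_swap23: "kleinfeld w y x z = - kleinfeld w x y z"
  by (metis kleinfeld_cyc kleinfeld_swap34 minus_minus)

lemma kleinfeld_swap12: "kleinfeld x w y z = - kleinfeld w x y z"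
  by (metis kleinfeld_cyc kleinfeld_swap23 minus_minus)

lemma kleinfeld_same34 [simp]: "kleinfeld w x y y = 0"
  by (simp add: kleinfeld_def)

lemma kleinfeld_same [simp]:
  "kleinfeld x x y z = 0" "kleinfeld x y x z = 0" "kleinfeld x y z x = 0"
  "kleinfeld y x x z = 0" "kleinfeld y x z x = 0"
  by (metis kleinfeld_swap12 kleinfeld_swap23 kleinfeld_swap34 kleinfeld_same34 neg_equal_0_iff_equal)+

text \<open>
  Skew-symmetrizing the definition in \<open>w\<close> and \<open>x\<close> gives \<open>2f\<close> as a commutator associator plus
  error terms; the error terms of two such expressions add up to \<open>3f\<close> by the alternating sum, so
  one copy of \<open>f\<close> remains without any division.
\<close>

lemma kleinfeld_commutators: "kleinfeld w x y z = \<langle>\<lbrace>w, x\<rbrace>, y, z\<rangle> + \<langle>\<lbrace>y, z\<rbrace>, w, x\<rangle>"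
proof -
  have double: "kleinfeld w x y z + kleinfeld w x y z =
    \<langle>\<lbrace>w, x\<rbrace>, y, z\<rangle> + \<lbrace>w, \<langle>x, y, z\<rangle>\<rbrace> - \<lbrace>x, \<langle>y, z, w\<rangle>\<rbrace>" for w x y z :: 'a
  proof -
    have "kleinfeld w x y z + kleinfeld w x y z = kleinfeld w x y z - kleinfeld x w y z"
      by (simp add: kleinfeld_swap12[of x w])
    then show ?thesis
      unfolding kleinfeld_def type_commutator_def by (simp add: associator_lin associator_cyc[of w y z] algebra_simps)
  qed
  have "kleinfeld x y z w = - kleinfeld w x y z" "kleinfeld y z w x = kleinfeld w x y z"
    by (metis kleinfeld_cyc minus_minus)+
  then have triple: "(\<lbrace>w, \<langle>x, y, z\<rangle>\<rbrace> - \<lbrace>x, \<langle>y, z, w\<rangle>\<rbrace>) + (\<lbrace>y, \<langle>z, w, x\<rangle>\<rbrace> - \<lbrace>z, \<langle>w, x, y\<rangle>\<rbrace>) =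
      kleinfeld w x y z + kleinfeld w x y z + kleinfeld w x y z"
    and flip: "kleinfeld y z w x = kleinfeld w x y z"
    using kleinfeld_alternating_sum[of w x y z] by (simp_all add: algebra_simps)
  let ?k = "kleinfeld w x y z"
  have "(?k + ?k) + (?k + ?k) = (\<langle>\<lbrace>w, x\<rbrace>, y, z\<rangle> + \<langle>\<lbrace>y, z\<rbrace>, w, x\<rangle>) +
    ((\<lbrace>w, \<langle>x, y, z\<rangle>\<rbrace> - \<lbrace>x, \<langle>y, z, w\<rangle>\<rbrace>) + (\<lbrace>y, \<langle>z, w, x\<rangle>\<rbrace> - \<lbrace>z, \<langle>w, x, y\<rangle>\<rbrace>))"
    using double[of w x y z] double[of y z w x] unfolding flip by (simp add: algebra_simps)
  then show ?thesis unfolding triple by (simp add: add.assoc[symmetric])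
qed

section \<open>Associators with two fixed entries\<close>

lemma associator_mult_left: "\<langle>x * y, x, z\<rangle> = \<langle>y, x, z\<rangle> * x" "\<langle>y * x, x, z\<rangle> = x * \<langle>y, x, z\<rangle>"
  for x y z :: "'a :: alt_ring"
proof -
  show "\<langle>x * y, x, z\<rangle> = \<langle>y, x, z\<rangle> * x"
    using kleinfeld_same(2)[of x y z] unfolding kleinfeld_def by simp
  show "\<langle>y * x, x, z\<rangle> = x * \<langle>y, x, z\<rangle>"
    using kleinfeld_same(4)[of y x z] unfolding kleinfeld_def by simp
qed

text \<open>
  For fixed \<open>x\<close> and \<open>y\<close>, the operator \<open>A z = \<langle>x, y, z\<rangle>\<close> turns left multiplication by \<open>x\<close> or \<open>y\<close> into
  right multiplication and conversely. In particular its image is stable under both. The rules express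
  that Kleinfeld's function vanishes on repeated arguments.
\<close>

lemma associator_factor:
  fixes x y z :: "'a :: alt_ring"
  shows "\<langle>x, y, x * z\<rangle> = \<langle>x, y, z\<rangle> * x" "\<langle>x, y, z * x\<rangle> = x * \<langle>x, y, z\<rangle>"
    "\<langle>x, y, y * z\<rangle> = \<langle>x, y, z\<rangle> * y" "\<langle>x, y, z * y\<rangle> = y * \<langle>x, y, z\<rangle>"
  using associator_mult_left[of x z y] associator_mult_left[of z x y] associator_mult_left[of y z x] associator_mult_left[of z y x]
  by (simp_all add: associator_cyc[of _ x y, symmetric] associator_swap23[of _ x y] associator_cyc[of y _ x] dist)

lemma associator_factor':
  fixes x y z :: "'a :: alt_ring"
  shows "\<langle>x, x * y, z\<rangle> = \<langle>x, y, z\<rangle> * x" "\<langle>x, y * x, z\<rangle> = x * \<langle>x, y, z\<rangle>"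
  using associator_factor(1,2)[of x z y] by (simp_all add: associator_swap23[of x _ z] dist)

lemma associator_product_aux: "kleinfeld x y (x * y) z = \<langle>x, y, \<langle>x, y, z\<rangle>\<rangle>" for x y z :: "'a :: alt_ring"
proof -
  have "\<langle>y, x * y, z\<rangle> = - (y * \<langle>x, y, z\<rangle>)"
    using associator_factor'(2)[of y x z] by (simp add: associator_swap12[of y x] dist)
  then have "kleinfeld x y (x * y) z = \<langle>y, \<langle>x, y, z\<rangle>, x\<rangle>"
    unfolding kleinfeld_def by (simp add: associator_factor' dist type_associator_def[of y _ x])
  then show ?thesis by (simp add: associator_cyc[of x y])
qed

text \<open>
  With \<open>v = \<lbrace>x, y\<rbrace>\<close> the operator \<open>A\<close> satisfies \<open>A (A z) = v * A z = - (A z * v)\<close>: the commutator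
  anticommutes with every associator \<open>A z\<close>. Both formulas come from evaluating \<open>A\<close> on the two bracketings
  of a triple product whose difference is \<open>A z\<close>, once directly by the product rules and once
  through Kleinfeld's function.
\<close>

lemma associator_iterate:
  fixes x y z :: "'a :: alt_ring"
  shows "\<langle>x, y, \<langle>x, y, z\<rangle>\<rangle> = \<lbrace>x, y\<rbrace> * \<langle>x, y, z\<rangle>" "\<langle>x, y, \<langle>x, y, z\<rangle>\<rangle> = - (\<langle>x, y, z\<rangle> * \<lbrace>x, y\<rbrace>)"
proof -
  let ?a = "\<langle>x, y, z\<rangle>"
  have [simp]: "\<langle>x, y, x * y\<rangle> = 0" "\<langle>x, y, y * x\<rangle> = 0"
    by (simp_all add: associator_factor)
  have zxy: "\<langle>z, x, y\<rangle> = ?a" "\<langle>w, x, y\<rangle> = \<langle>x, y, w\<rangle>" for w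
    by (metis associator_cyc)+
  have "kleinfeld (x * y) z x y = \<langle>x, y, ?a\<rangle>"
    by (metis associator_product_aux kleinfeld_cyc minus_minus)
  then have 1: "\<langle>x, y, (x * y) * z\<rangle> = \<langle>x, y, ?a\<rangle> + ?a * (x * y)"
    unfolding kleinfeld_def by (simp add: zxy algebra_simps)
  have "\<langle>x, y, (x * y) * z\<rangle> = \<langle>x, y, ?a\<rangle> + \<langle>x, y, x * (y * z)\<rangle>"
    unfolding associator_add[symmetric] by (simp add: type_associator_def)
  with 1 have "(?a * y) * x = ?a * (x * y)"
    by (simp add: associator_factor)
  then have "\<langle>?a, y, x\<rangle> = ?a * \<lbrace>x, y\<rbrace>"
    by (simp add: type_associator_def[of ?a y x] type_commutator_def dist)
  then show "\<langle>x, y, ?a\<rangle> = - (?a * \<lbrace>x, y\<rbrace>)"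
    by (metis associator_cyc associator_swap23)
  have "kleinfeld z (y * x) x y = \<langle>x, y, ?a\<rangle>"
    by (metis associator_product_aux kleinfeld_cyc kleinfeld_swap12 associator_swap12 associator_neg(3) minus_minus)
  then have 2: "\<langle>x, y, z * (y * x)\<rangle> = \<langle>x, y, ?a\<rangle> + (y * x) * ?a"
    unfolding kleinfeld_def by (simp add: zxy algebra_simps)
  have "(z * y) * x = z * (y * x) - ?a"
    using type_associator_def[of z y x] by (metis associator_swap23 zxy(1) add_diff_cancel_left' add_uminus_conv_diff diff_add_cancel)
  then have "\<langle>x, y, (z * y) * x\<rangle> = \<langle>x, y, z * (y * x)\<rangle> - \<langle>x, y, ?a\<rangle>"
    by (simp add: associator_lin)
  with 2 have "x * (y * ?a) = (y * x) * ?a"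
    by (simp add: associator_factor)
  then show "\<langle>x, y, ?a\<rangle> = \<lbrace>x, y\<rbrace> * ?a"
    by (simp add: type_associator_def[of x y ?a] type_commutator_def dist)
qed


section \<open>Nucleus, center and zero divisors\<close>

definition nuclear :: "'a :: alt_ring \<Rightarrow> bool"
  where "nuclear n \<longleftrightarrow> (\<forall>y z. \<langle>n, y, z\<rangle> = 0)"

definition central :: "'a :: alt_ring \<Rightarrow> bool"
  where "central c \<longleftrightarrow> nuclear c \<and> (\<forall>x. \<lbrace>c, x\<rbrace> = 0)"

lemma nuclear_associator: "nuclear n \<Longrightarrow> \<langle>n, y, z\<rangle> = 0" "nuclear n \<Longrightarrow> \<langle>y, n, z\<rangle> = 0" "nuclear n \<Longrightarrow> \<langle>y, z, n\<rangle> = 0"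
  unfolding nuclear_def by (metis associator_cyc)+

lemma square_associator: "\<langle>u * u, y, z\<rangle> = u * \<langle>u, y, z\<rangle> + \<langle>u, y, z\<rangle> * u" for u y z :: "'a :: alt_ring"
  using kleinfeld_same(1)[of u y z] unfolding kleinfeld_def by (simp add: algebra_simps)

text \<open>
  The associator \<open>\<langle>v, x, z\<rangle>\<close> lies in the image of \<open>A\<close>, hence anticommutes with \<open>v\<close>, and the associator of
  \<open>v * v\<close> is the symmetrized product of \<open>v\<close> with that of \<open>v\<close>.
\<close>

lemma commutator_square_associator:
  fixes x y z :: "'a :: alt_ring"
  shows "\<langle>\<lbrace>x, y\<rbrace> * \<lbrace>x, y\<rbrace>, x, z\<rangle> = 0" "\<langle>\<lbrace>x, y\<rbrace> * \<lbrace>x, y\<rbrace>, y, z\<rangle> = 0"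
proof -
  have *: "\<langle>\<lbrace>x, y\<rbrace> * \<lbrace>x, y\<rbrace>, x, z\<rangle> = 0" for x y :: 'a
  proof -
    have "\<langle>x, \<lbrace>x, y\<rbrace>, z\<rangle> = \<langle>x, y, x * z - z * x\<rangle>"
      by (simp add: type_commutator_def associator_lin associator_factor associator_factor')
    then have "\<langle>\<lbrace>x, y\<rbrace>, x, z\<rangle> = - \<langle>x, y, x * z - z * x\<rangle>"
      by (simp add: associator_swap12[of x])
    then show ?thesis
      using associator_iterate[of x y "x * z - z * x"] by (simp add: square_associator dist)
  qed
  show "\<langle>\<lbrace>x, y\<rbrace> * \<lbrace>x, y\<rbrace>, x, z\<rangle> = 0" by (rule *)
  have "\<lbrace>y, x\<rbrace> = - \<lbrace>x, y\<rbrace>" by (simp add: type_commutator_def)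
  with *[of y x] show "\<langle>\<lbrace>x, y\<rbrace> * \<lbrace>x, y\<rbrace>, y, z\<rangle> = 0" by (simp add: dist)
qed

section \<open>Commutator squares and quadratic equations\<close>

text \<open>
  The type argument only serves to fix the ring; all statements range over the whole type.
\<close>

locale alternative_domain =
  fixes dummy :: "'a :: alt_ring itself"
  assumes no_zero_divisors: "x * y = 0 \<Longrightarrow> x = 0 \<or> y = (0 :: 'a)"
begin

text \<open>
  Multiplication by \<open>v * v\<close> on the image of \<open>A\<close> is the square of \<open>A\<close>, which commutes with left
  multiplication by \<open>x\<close>. As \<open>v * v\<close> also associates with \<open>x\<close>, the commutator of the
  two kills the nonzero element \<open>A z\<close>.
\<close>

lemma commutator_square_commutes:
  fixes x y :: 'a
  assumes "\<langle>x, y, z\<rangle> \<noteq> 0"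
  shows "\<lbrace>\<lbrace>x, y\<rbrace> * \<lbrace>x, y\<rbrace>, x\<rbrace> = 0" "\<lbrace>\<lbrace>x, y\<rbrace> * \<lbrace>x, y\<rbrace>, y\<rbrace> = 0"
proof -
  have *: "\<lbrace>\<lbrace>x, y\<rbrace> * \<lbrace>x, y\<rbrace>, x\<rbrace> = 0" if "\<langle>x, y, z\<rangle> \<noteq> 0" for x y :: 'a
  proof -
    let ?v = "\<lbrace>x, y\<rbrace>" and ?A = "\<lambda>z. \<langle>x, y, z\<rangle>"
    let ?n = "?v * ?v" and ?a = "?A z"
    have n: "?n * ?A w = ?A (?A (?A w))" for w
      using associator_iterate(1)[of x y "?A w"] by (simp add: associator_iterate(1) alt_l)
    have "?n * (x * ?a) = x * (?n * ?a)"
      using n[of "z * x"] n[of z] by (simp add: associator_factor)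
    moreover have "(?n * x) * ?a = ?n * (x * ?a)"
      using commutator_square_associator(1)[of x y ?a] by (simp add: type_associator_def)
    moreover have "(x * ?n) * ?a = x * (?n * ?a)"
      using commutator_square_associator(1)[of x y ?a] associator_swap12[of ?n x ?a] by (simp add: type_associator_def)
    ultimately have "\<lbrace>?n, x\<rbrace> * ?a = 0"
      by (simp add: type_commutator_def dist)
    with that show ?thesis
      using no_zero_divisors by blast
  qed
  show "\<lbrace>\<lbrace>x, y\<rbrace> * \<lbrace>x, y\<rbrace>, x\<rbrace> = 0" by (rule *[OF assms])
  have "\<lbrace>y, x\<rbrace> = - \<lbrace>x, y\<rbrace>" by (simp add: type_commutator_def)
  with *[of y x] assms show "\<lbrace>\<lbrace>x, y\<rbrace> * \<lbrace>x, y\<rbrace>, y\<rbrace> = 0"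
    by (simp add: dist associator_swap12[of y x])
qed

text \<open>
  Let \<open>n = v * v\<close>. Since \<open>n\<close> associates and commutes with \<open>x\<close> and \<open>y\<close>, Kleinfeld's function
  vanishes at \<open>n, x\<close> and \<open>n, y\<close>, so factors \<open>x\<close> and \<open>y\<close> can be pulled out of both free arguments of
  \<open>\<langle>n, z, w\<rangle>\<close>. Pulling them out of two arguments in two different orders shows that \<open>b = \<langle>n, z, w\<rangle>\<close>
  satisfies \<open>(b * x) * y = (b * y) * x\<close> and associates with \<open>x\<close> and \<open>y\<close>; together, \<open>b * v = 0\<close>.
\<close>

theorem commutator_square_nuclear:
  fixes x y :: 'a
  assumes "\<langle>x, y, u\<rangle> \<noteq> 0"
  shows "nuclear (\<lbrace>x, y\<rbrace> * \<lbrace>x, y\<rbrace>)"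
  unfolding nuclear_def
proof (intro allI)
  fix z w
  define v where "v = \<lbrace>x, y\<rbrace>"
  define n where "n = v * v"
  have factor: "\<langle>n, p * z, w\<rangle> = \<langle>n, z, w\<rangle> * p" "\<langle>n, z * p, w\<rangle> = p * \<langle>n, z, w\<rangle>"
    "\<langle>n, z, p * w\<rangle> = \<langle>n, z, w\<rangle> * p" "\<langle>n, z, w * p\<rangle> = p * \<langle>n, z, w\<rangle>" if p: "p = x \<or> p = y" for p z w
  proof -
    have np: "\<langle>n, p, z\<rangle> = 0" "\<lbrace>n, p\<rbrace> = 0" for z
      using commutator_square_associator[of x y z] commutator_square_commutes[OF assms] p
      unfolding n_def v_def by auto
    have pn: "\<langle>p, n, z\<rangle> = 0" "\<langle>z, n, p\<rangle> = 0" "\<langle>z, p, n\<rangle> = 0" for z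
      using np by (metis associator_cyc associator_swap12 neg_equal_0_iff_equal)+
    have K: "kleinfeld n p z w = 0" for z w
      unfolding kleinfeld_commutators np
      using associator_cyc[of n p] by (simp add: np associator_cyc[of _ n p])
    have 1: "\<langle>n, p * z, w\<rangle> = \<langle>n, z, w\<rangle> * p" for z w
    proof -
      have "kleinfeld p z n w = 0"
        using K[of z w] by (metis kleinfeld_cyc kleinfeld_swap34 kleinfeld_swap12 kleinfeld_swap23 neg_equal_0_iff_equal)
      then show ?thesis
        unfolding kleinfeld_def by (simp add: np pn associator_swap12[of _ n] dist)
    qed
    have 2: "\<langle>n, z * p, w\<rangle> = p * \<langle>n, z, w\<rangle>" for z w
    proof -
      have "kleinfeld z p n w = 0"
        using K[of z w] by (metis kleinfeld_cyc kleinfeld_swap34 kleinfeld_swap12 kleinfeld_swap23 neg_equal_0_iff_equal)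
      then show ?thesis
        unfolding kleinfeld_def by (simp add: np pn associator_swap12[of _ n] dist)
    qed
    show "\<langle>n, p * z, w\<rangle> = \<langle>n, z, w\<rangle> * p" "\<langle>n, z * p, w\<rangle> = p * \<langle>n, z, w\<rangle>" by (fact 1 2)+
    show "\<langle>n, z, p * w\<rangle> = \<langle>n, z, w\<rangle> * p" "\<langle>n, z, w * p\<rangle> = p * \<langle>n, z, w\<rangle>"
      using 1[of w z] 2[of w z] by (simp_all add: associator_swap23[of n _ z] dist)
  qed
  \<comment> \<open>Evaluate \<open>\<langle>n, x * z, y * w\<rangle>\<close> and \<open>\<langle>n, x * z, w * y\<rangle>\<close> in two ways each.\<close>
  let ?b = "\<langle>n, z, w\<rangle>"
  have "(?b * x) * y = (?b * y) * x"
    using factor(1)[of x z "y * w"] factor(3)[of y "x * z" w] by (simp add: factor)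
  moreover have "y * (?b * x) = (y * ?b) * x"
    using factor(1)[of x z "w * y"] factor(4)[of y "x * z" w] by (simp add: factor)
  then have "\<langle>y, ?b, x\<rangle> = 0" by (simp add: type_associator_def)
  then have "\<langle>?b, x, y\<rangle> = 0" "\<langle>?b, y, x\<rangle> = 0"
    by (metis associator_cyc associator_swap12 neg_equal_0_iff_equal)+
  ultimately have "?b * v = 0"
    by (simp add: type_associator_def v_def type_commutator_def dist)
  then have "?b = 0 \<or> v = 0" using no_zero_divisors by blast
  then show "\<langle>\<lbrace>x, y\<rbrace> * \<lbrace>x, y\<rbrace>, z, w\<rangle> = 0"
    unfolding v_def[symmetric] n_def[symmetric] by (auto simp: n_def)
qed

end

lemma associator_perm_zero: "\<langle>x, y, z\<rangle> = 0 \<Longrightarrow> \<langle>y, x, z\<rangle> = 0 \<and> \<langle>y, z, x\<rangle> = 0 \<and> \<langle>z, x, y\<rangle> = 0 \<and> \<langle>x, z, y\<rangle> = 0 \<and> \<langle>z, y, x\<rangle> = 0"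
  for x y z :: "'a :: alt_ring"
  by (metis associator_cyc associator_swap12 neg_equal_0_iff_equal)

lemma kleinfeld_nuclear: "nuclear n \<Longrightarrow> kleinfeld n x y z = 0"
proof -
  assume n: "nuclear n"
  have "kleinfeld n x y z = kleinfeld y z n x"
    by (metis kleinfeld_cyc minus_minus)
  then show ?thesis
    unfolding kleinfeld_def by (simp add: nuclear_associator[OF n])
qed

text \<open>
  A nuclear argument annihilates Kleinfeld's function, as all terms vanish when it is
  placed third; written with it in first place this says that nuclear elements commute with associators.
\<close>

lemma nuclear_commutes_associator:
  assumes n: "nuclear n"
  shows "n * \<langle>x, y, z\<rangle> = \<langle>n * x, y, z\<rangle>" "\<langle>x, y, z\<rangle> * n = \<langle>n * x, y, z\<rangle>"
proof -
  show "n * \<langle>x, y, z\<rangle> = \<langle>n * x, y, z\<rangle>"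
    using teichmueller[of n x y z] by (simp add: nuclear_associator[OF n])
  show "\<langle>x, y, z\<rangle> * n = \<langle>n * x, y, z\<rangle>"
    using kleinfeld_nuclear[OF n, of x y z] unfolding kleinfeld_def by (simp add: nuclear_associator[OF n])
qed

lemma nuclear_diff: "nuclear m \<Longrightarrow> nuclear n \<Longrightarrow> nuclear (m - n)"
  by (simp add: nuclear_def associator_lin)

lemma central_diff: "central c \<Longrightarrow> central d \<Longrightarrow> central (c - d)"
  by (simp add: central_def nuclear_def associator_lin type_commutator_def dist)

lemma central_zero [simp]: "central 0"
  by (simp add: central_def nuclear_def type_commutator_def)

lemma central_neg: "central c \<Longrightarrow> central (- c)"
  using central_diff[of 0 c] by simp

lemma central_add: "central c \<Longrightarrow> central d \<Longrightarrow> central (c + d)"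
  using central_diff[of c "- d"] central_neg[of d] by simp

lemma central_commutes: "central c \<Longrightarrow> c * x = x * c"
  by (simp add: central_def type_commutator_def)

lemma central_associator: "central c \<Longrightarrow> \<langle>c, y, z\<rangle> = 0" "central c \<Longrightarrow> \<langle>y, c, z\<rangle> = 0" "central c \<Longrightarrow> \<langle>y, z, c\<rangle> = 0"
  by (simp_all add: central_def nuclear_associator)

lemma central_mult_left: "central c \<Longrightarrow> (c * x) * y = c * (x * y)"
  using central_associator(1)[of c x y] by (simp add: type_associator_def)

lemma central_mult_right: "central c \<Longrightarrow> x * (c * y) = c * (x * y)"
  using central_associator(2)[of c x y] central_commutes[of c x] central_mult_left[of c x y] by (simp add: type_associator_def)

lemma central_mult:
  assumes c: "central c" and d: "central d"
  shows "central (c * d)"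
  unfolding central_def nuclear_def
proof (intro conjI allI)
  show "\<langle>c * d, y, z\<rangle> = 0" for y z
    by (simp add: type_associator_def central_mult_left c d)
  show "\<lbrace>c * d, x\<rbrace> = 0" for x
    by (simp add: type_commutator_def central_mult_left central_mult_right c central_commutes[OF d, of x])
qed

text \<open>
  If \<open>x * y = 0\<close> then \<open>\<langle>x, y, z\<rangle> * x = \<langle>x, x * y, z\<rangle> = 0\<close>, so \<open>\<langle>x, y, z\<rangle> = 0\<close> for every \<open>z\<close>. If \<open>u * u = 0\<close>, this
  applies to \<open>u * (u * z) = 0\<close> as well, so \<open>u\<close> is nuclear. A nuclear zero divisor would make every
  associator a zero divisor or zero, so there is none; hence squares of nonzero elements are nonzero, and \<open>x * y = 0\<close> implies \<open>y * x = 0\<close>. Then \<open>y * z\<close> is annihilated by \<open>x\<close> and \<open>x * z\<close> by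
  \<open>y\<close> as well, and comparing the values of Kleinfeld's function at permutations of \<open>x, y, z, w\<close> gives
  \<open>y * \<langle>x, z, w\<rangle> = 0\<close>. So \<open>x\<close> is nuclear, a case already excluded.
\<close>

theorem regular_associators_no_zero_divisors:
  fixes x y :: "'a :: alt_ring"
  assumes regular: "\<And>x y z u :: 'a. \<langle>x, y, z\<rangle> * u = 0 \<or> u * \<langle>x, y, z\<rangle> = 0 \<Longrightarrow> \<langle>x, y, z\<rangle> = 0 \<or> u = 0"
    and proper: "\<exists>p q r :: 'a. \<langle>p, q, r\<rangle> \<noteq> 0"
    and zero: "x * y = 0"
  shows "x = 0 \<or> y = 0"
proof -
  have asr0: "\<langle>x, y, z\<rangle> = 0" if "x * y = 0" for x y z :: 'a
    using associator_factor'(1)[of x y z] regular[of x y z x] that by auto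
  have nuclear_regular: "n = 0 \<or> m = 0" if n: "nuclear n" and nm: "n * m = 0" for n m :: 'a
  proof (rule ccontr)
    assume "\<not> (n = 0 \<or> m = 0)"
    have "\<langle>p, q, r\<rangle> = 0" for p q r :: 'a
    proof -
      have "(\<langle>p, q, r\<rangle> * n) * m = 0"
        using nuclear_associator(2)[OF n, of "\<langle>p, q, r\<rangle>" m] nm by (simp add: type_associator_def)
      then have "\<langle>n * p, q, r\<rangle> = 0"
        using regular[of "n * p" q r m] \<open>\<not> (n = 0 \<or> m = 0)\<close> by (auto simp: nuclear_commutes_associator[OF n])
      then show ?thesis
        using regular[of p q r n] \<open>\<not> (n = 0 \<or> m = 0)\<close> by (simp add: nuclear_commutes_associator[OF n])
    qed
    with proper show False by blast
  qed
  have square: "u = 0" if u: "u * u = 0" for u :: 'a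
  proof -
    have "\<langle>u, z, w\<rangle> = 0 \<or> u = 0" for z w
    proof -
      have "u * (u * z) = 0"
        using alt_l[of u z] u by simp
      then have "\<langle>u, z, w\<rangle> * u = 0"
        using asr0[of u "u * z" w] by (simp add: associator_factor')
      then show ?thesis using regular[of u z w u] by simp
    qed
    then have "nuclear u \<or> u = 0" by (auto simp: nuclear_def)
    then show ?thesis using nuclear_regular[of u u] u by auto
  qed
  have reversible: "y * x = 0" if xy: "x * y = 0" for x y :: 'a
  proof (rule square)
    have "\<langle>y * x, y, x\<rangle> = 0" by (simp add: associator_mult_left)
    then show "(y * x) * (y * x) = 0"
      using xy by (simp add: type_associator_def flexible)
  qed
  have "\<langle>x, z, w\<rangle> = 0 \<or> y = 0" for z w
  proof -
    have yx: "y * x = 0" using zero by (rule reversible)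
    have xy0: "\<langle>x, y, u\<rangle> = 0" "\<langle>y, x, u\<rangle> = 0" "\<langle>x, u, y\<rangle> = 0" "\<langle>u, y, x\<rangle> = 0" for u
      using asr0[OF zero, of u] associator_perm_zero[of x y u] by simp_all
    have "x * (y * z) = 0" "(z * y) * x = 0"
      using xy0[of z] zero yx by (simp_all add: type_associator_def)
    then have "(y * z) * x = 0" "x * (z * y) = 0" by (simp_all add: reversible)
    with xy0(3)[of z] have "(y * z) * x = 0" "(x * z) * y = 0"
      by (simp_all add: type_associator_def)
    then have *: "\<langle>y * z, x, w\<rangle> = 0" "\<langle>x * z, y, w\<rangle> = 0" by (simp_all add: asr0)
    let ?k = "kleinfeld x y z w"
    have "kleinfeld y z x w = ?k" "kleinfeld x z y w = - ?k"
      by (metis kleinfeld_swap12 kleinfeld_swap23 minus_minus)+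
    then have "\<langle>x, z, w\<rangle> * y = ?k" "\<langle>y, z, w\<rangle> * x = - ?k"
      unfolding kleinfeld_def[of y z x w] kleinfeld_def[of x z y w] * xy0
        associator_swap12[of z x w] associator_swap12[of z y w]
      by (simp_all add: dist)
    moreover have "?k = - (y * \<langle>x, z, w\<rangle>) - \<langle>y, z, w\<rangle> * x"
      unfolding kleinfeld_def[of x y z w] zero by simp
    ultimately have "?k = - (y * \<langle>x, z, w\<rangle>) - (- ?k)" by metis
    then have "y * \<langle>x, z, w\<rangle> = 0" by simp
    then show ?thesis using regular[of x z w y] by simp
  qed
  then show ?thesis
    using nuclear_regular[of x y] zero by (auto simp: nuclear_def)
qed

context alternative_domain
begin

text \<open>
  A group is not the union of two proper subgroups. This replaces genericity arguments: two
  additive conditions that cannot fail simultaneously cannot both be proper.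
\<close>

lemma additive_subgroup_cover:
  fixes P Q :: "'b :: ab_group_add \<Rightarrow> bool"
  assumes cover: "\<And>y. P y \<or> Q y"
    and P: "\<And>x y. P x \<Longrightarrow> P y \<Longrightarrow> P (x - y)"
    and Q: "\<And>x y. Q x \<Longrightarrow> Q y \<Longrightarrow> Q (x - y)"
  shows "(\<forall>y. P y) \<or> (\<forall>y. Q y)"
proof (rule ccontr)
  assume "\<not> ?thesis"
  then obtain p q where "\<not> P p" "\<not> Q q" by blast
  with cover have "Q p" "P q" by blast+
  show False
  proof (cases "P (p + q)")
    case True
    with P[OF this \<open>P q\<close>] \<open>\<not> P p\<close> show False by simp
  next
    case False
    with cover have "Q (p + q)" by blast
    with Q[OF this \<open>Q p\<close>] \<open>\<not> Q q\<close> show False by simp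
  qed
qed

text \<open>
  A nuclear \<open>n\<close> commutes with \<open>a = \<langle>x, y, z\<rangle>\<close> and with \<open>a * x = \<langle>x, y, x * z\<rangle>\<close>, hence \<open>a * \<lbrace>n, x\<rbrace> = 0\<close>.
  So \<open>n\<close> commutes with every non-nuclear \<open>x\<close>, and the non-nuclear elements generate the ring additively.
\<close>

theorem nuclear_imp_central:
  fixes n :: 'a
  assumes n: "nuclear n" and proper: "\<exists>p q r :: 'a. \<langle>p, q, r\<rangle> \<noteq> 0"
  shows "central n"
proof -
  have "nuclear x \<or> \<lbrace>n, x\<rbrace> = 0" for x
  proof (cases "nuclear x")
    case False
    then obtain y z where a: "\<langle>x, y, z\<rangle> \<noteq> 0" by (auto simp: nuclear_def)
    let ?a = "\<langle>x, y, z\<rangle>"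
    have na: "n * ?a = ?a * n" and nax: "n * (?a * x) = (?a * x) * n"
      using nuclear_commutes_associator[OF n, of x y z] nuclear_commutes_associator[OF n, of x y "x * z"]
      by (simp_all add: associator_factor)
    have "n * (?a * x) = (n * ?a) * x" "(?a * n) * x = ?a * (n * x)" "(?a * x) * n = ?a * (x * n)"
      using nuclear_associator[OF n] by (simp_all add: type_associator_def)
    with na nax have "?a * \<lbrace>n, x\<rbrace> = 0"
      by (simp add: type_commutator_def dist)
    with a show ?thesis using no_zero_divisors by blast
  qed simp
  then have "(\<forall>x :: 'a. nuclear x) \<or> (\<forall>x. \<lbrace>n, x\<rbrace> = 0)"
    by (rule additive_subgroup_cover) (auto simp: nuclear_diff type_commutator_def dist algebra_simps)
  then show ?thesis
    using n proper by (auto simp: central_def nuclear_def)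
qed

text \<open>
  When \<open>x\<close> commutes with everything, \<open>A z = \<langle>x, y, z\<rangle>\<close> is a derivation with \<open>A (A z) = 0\<close>, so
  \<open>A (A (z * z)) = 2 (A z)^2\<close> must vanish.
\<close>

lemma commuting_imp_nuclear:
  fixes x :: 'a
  assumes comm: "\<And>y. \<lbrace>x, y\<rbrace> = 0" and two: "\<And>y :: 'a. y + y = 0 \<Longrightarrow> y = 0"
  shows "nuclear x"
  unfolding nuclear_def
proof (intro allI)
  fix y z
  have deriv: "\<langle>x, y, w * z\<rangle> = \<langle>x, y, w\<rangle> * z + w * \<langle>x, y, z\<rangle>" for w z
  proof -
    have 1: "kleinfeld w z x y = \<langle>\<lbrace>w, z\<rbrace>, x, y\<rangle>" for w z
      using kleinfeld_commutators[of x y w z] comm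
      by (metis add_0 associator_zero(1) kleinfeld_cyc minus_minus)
    from 1 have "\<langle>z * w, x, y\<rangle> = z * \<langle>w, x, y\<rangle> + \<langle>z, x, y\<rangle> * w" for w z
      unfolding kleinfeld_def type_commutator_def associator_lin by (simp add: algebra_simps)
    then show ?thesis by (simp add: associator_cyc[of x] associator_cyc[of y] add.commute)
  qed
  let ?a = "\<langle>x, y, z\<rangle>"
  have AA: "\<langle>x, y, \<langle>x, y, w\<rangle>\<rangle> = 0" for w
    using associator_iterate(1)[of x y w] comm by simp
  have "?a * ?a + ?a * ?a = 0"
    using AA[of "z * z"] by (simp add: deriv AA associator_lin)
  then show "?a = 0"
    using two no_zero_divisors by blast
qed

lemma two_torsion_free:
  assumes "x + x \<noteq> (0 :: 'a)" "y + y = (0 :: 'a)"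
  shows "y = 0"
proof -
  have "(x + x) * y = x * (y + y)" by (simp add: dist)
  with assms show ?thesis using no_zero_divisors by force
qed

lemma noncommuting_nonassociating:
  fixes x :: 'a
  assumes x: "\<not> nuclear x" and two: "\<And>y :: 'a. y + y = 0 \<Longrightarrow> y = 0"
  shows "\<exists>y z. \<lbrace>x, y\<rbrace> \<noteq> 0 \<and> \<langle>x, y, z\<rangle> \<noteq> 0"
proof (rule ccontr)
  assume "\<not> ?thesis"
  then have "\<lbrace>x, y\<rbrace> = 0 \<or> (\<forall>z. \<langle>x, y, z\<rangle> = 0)" for y by blast
  then have "(\<forall>y. \<lbrace>x, y\<rbrace> = 0) \<or> (\<forall>y z. \<langle>x, y, z\<rangle> = 0)"
    by (rule additive_subgroup_cover) (auto simp: type_commutator_def dist associator_lin algebra_simps)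
  with x commuting_imp_nuclear[OF _ two] show False by (auto simp: nuclear_def)
qed

text \<open>
  Choose \<open>y\<close> with \<open>v = \<lbrace>x, y\<rbrace> \<noteq> 0\<close> and \<open>\<langle>x, y, R\<rangle> \<noteq> 0\<close>. Replacing \<open>y\<close> by \<open>x * y\<close> replaces \<open>v\<close> by \<open>x * v\<close>, so the
  squares of \<open>v\<close>, of \<open>w = x * v\<close> and of \<open>v + w\<close> or \<open>v - w\<close> are central. Hence so is \<open>v * w + w * v\<close>,
  and multiplying that element by \<open>x\<close> yields the equation.
\<close>

theorem quadratic_equation:
  fixes x :: 'a
  assumes x: "\<not> nuclear x" and two: "\<And>y :: 'a. y + y = 0 \<Longrightarrow> y = 0"
  shows "\<exists>c d e. central c \<and> central d \<and> central e \<and> c \<noteq> 0 \<and> c * (x * x) = d * x - e"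
proof -
  have proper: "\<exists>p q r :: 'a. \<langle>p, q, r\<rangle> \<noteq> 0" using x by (auto simp: nuclear_def)
  obtain y z where v0: "\<lbrace>x, y\<rbrace> \<noteq> 0" and a: "\<langle>x, y, z\<rangle> \<noteq> 0"
    using noncommuting_nonassociating[OF x two] by blast
  have sq: "central (\<lbrace>x, y\<rbrace> * \<lbrace>x, y\<rbrace>)" if "\<langle>x, y, z\<rangle> \<noteq> 0" for y z
    using commutator_square_nuclear[OF that] nuclear_imp_central proper by blast
  define v where "v = \<lbrace>x, y\<rbrace>"
  define w where "w = x * v"
  \<comment> \<open>Passing from \<open>y\<close> to \<open>x * y\<close> multiplies both the commutator and the associator by \<open>x\<close>.\<close>
  have w: "\<lbrace>x, x * y\<rbrace> = w"
    by (simp add: w_def v_def type_commutator_def dist flexible)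
  have x0: "x \<noteq> 0" using a by auto
  have vv: "central (v * v)" using sq[OF a] by (simp add: v_def)
  have ax: "\<langle>x, x * y, z\<rangle> \<noteq> 0"
    using no_zero_divisors[of "\<langle>x, y, z\<rangle>" x] a x0 by (auto simp: associator_factor')
  have ww: "central (w * w)" using sq[OF ax] by (simp add: w)
  have c1: "central (v * w + w * v)"
  proof -
    \<comment> \<open>Without an identity element \<open>1 + x\<close> is not available; two candidates take its place, and their associators add up to \<open>2 \<langle>x, y, z\<rangle>\<close>.\<close>
    have "\<langle>x, y + x * y, z\<rangle> \<noteq> 0 \<or> \<langle>x, y - x * y, z\<rangle> \<noteq> 0"
    proof (rule ccontr)
      assume "\<not> ?thesis"
      then have "\<langle>x, y + x * y, z\<rangle> + \<langle>x, y - x * y, z\<rangle> = 0" by simp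
      then have "\<langle>x, y, z\<rangle> + \<langle>x, y, z\<rangle> = 0"
        unfolding associator_lin by (simp add: algebra_simps)
      with two a show False by blast
    qed
    then show ?thesis
    proof
      assume "\<langle>x, y + x * y, z\<rangle> \<noteq> 0"
      moreover have "\<lbrace>x, y + x * y\<rbrace> = v + w"
        using w by (simp add: v_def type_commutator_def dist algebra_simps)
      ultimately have "central ((v + w) * (v + w) - v * v - w * w)"
        using sq[of "y + x * y" z] vv ww by (simp add: central_diff)
      then show ?thesis by (simp add: dist algebra_simps)
    next
      assume "\<langle>x, y - x * y, z\<rangle> \<noteq> 0"
      moreover have "\<lbrace>x, y - x * y\<rbrace> = v - w"
        using w by (simp add: v_def type_commutator_def dist algebra_simps)
      ultimately have "central (v * v - ((v - w) * (v - w) - w * w))"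
        using sq[of "y - x * y" z] vv ww by (simp add: central_diff)
      then show ?thesis by (simp add: dist algebra_simps)
    qed
  qed
  have "(v * v) * (x * x) = (v * w + w * v) * x - w * w"
  proof -
    have "x * (v * w) = w * w"
      using associator_factor(1)[of x v v] by (simp add: type_associator_def w_def)
    moreover have "x * (w * v) = (v * v) * (x * x)"
      unfolding w_def alt_r alt_l[of x "v * v", symmetric] by (rule central_commutes[OF vv, symmetric])
    ultimately show ?thesis
      using central_commutes[OF c1, of x] by (simp add: dist)
  qed
  moreover have "v * v \<noteq> 0" using no_zero_divisors[of v v] v0 by (auto simp: v_def)
  ultimately show ?thesis
    using vv ww c1 by (intro exI[of _ "v * v"] exI[of _ "v * w + w * v"] exI[of _ "w * w"]) simp
qed

end

section \<open>Pure elements, conjugation and the norm form\<close>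

lemma central_scale_associator:
  assumes c: "central c"
  shows "\<langle>c * x, y, z\<rangle> = c * \<langle>x, y, z\<rangle>" "\<langle>x, c * y, z\<rangle> = c * \<langle>x, y, z\<rangle>" "\<langle>x, y, c * z\<rangle> = c * \<langle>x, y, z\<rangle>"
  by (simp_all add: type_associator_def dist central_mult_left[OF c] central_mult_right[OF c])

text \<open>
  The situation of the central quotient: a unital alternative domain of characteristic not 2, not associative,
  whose center is a field. The constant \<open>e\<close> is its identity element.
\<close>

locale central_division_domain = alternative_domain dummy for dummy :: "'a :: alt_ring itself" +
  fixes e :: 'a
  assumes unit [simp]: "e * x = x" "x * e = x"
    and proper: "\<exists>p q r :: 'a. \<langle>p, q, r\<rangle> \<noteq> 0"
    and two: "y + y = 0 \<Longrightarrow> y = (0 :: 'a)"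
    and central_inverse: "central c \<Longrightarrow> c \<noteq> 0 \<Longrightarrow> \<exists>d. central d \<and> c * d = e"
begin

lemma central_unit [simp]: "central e"
  by (simp add: central_def nuclear_def type_associator_def type_commutator_def)

lemma unit_nonzero [simp]: "e \<noteq> 0"
  using proper by (metis unit(1) zero_mult associator_zero(1))

lemma central_cancel:
  fixes x :: 'a
  assumes c: "central c" "c \<noteq> 0" and cx: "central (c * x)"
  shows "central x"
proof -
  obtain d where d: "central d" "c * d = e" using central_inverse c by blast
  have "d * (c * x) = x"
    using central_mult_left[OF d(1), of c x] d central_commutes[OF c(1), of d] by simp
  with central_mult[OF d(1) cx] show ?thesis by simp
qed

lemma half: obtains h :: 'a where "central h" "\<And>x. h * x + h * x = x"
proof -
  have "e + e \<noteq> 0" using two unit_nonzero by blast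
  then obtain h where h: "central h" "(e + e) * h = e"
    using central_inverse central_add central_unit by blast
  have "h + h = e" using h(2) unfolding dist by simp
  then have "h * x + h * x = x" for x
    unfolding dist_r[symmetric] by simp
  then show thesis by (rule that[OF h(1)])
qed

lemma quadratic:
  fixes x :: 'a
  obtains t n where "central t" "central n" "x * x = t * x - n"
proof (cases "nuclear x")
  case True
  from nuclear_imp_central[OF this proper] show thesis using that[of x 0] by simp
next
  case False
  obtain c s m where c: "central c" "central s" "central m" "c \<noteq> 0" "c * (x * x) = s * x - m"
    using quadratic_equation[OF False two] by blast
  obtain d where d: "central d" "c * d = e" using central_inverse c by blast
  have "x * x = d * (c * (x * x))"
    using central_mult_left[OF d(1), of c "x * x"] d central_commutes[OF c(1), of d] by simp
  also have "\<dots> = (d * s) * x - d * m"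
    unfolding c(5) by (simp add: dist central_mult_left[OF d(1)])
  finally show thesis using that[of "d * s" "d * m"] central_mult c d by blast
qed

text \<open>
  The elements of trace zero, recognized by having a central square without being central.
\<close>

definition pure :: "'a \<Rightarrow> bool"
  where "pure u \<longleftrightarrow> central (u * u) \<and> (central u \<longrightarrow> u = 0)"

lemma pure_zero [simp]: "pure 0"
  by (simp add: pure_def)

lemma pure_scale:
  assumes c: "central c" and u: "pure u"
  shows "pure (c * u)"
proof (cases "c = 0")
  case False
  have "(c * u) * (c * u) = (c * c) * (u * u)"
    by (simp add: central_mult_left[OF c] central_mult_right[OF c, of u])
  then show ?thesis
    using u central_mult[OF central_mult[OF c c]] central_cancel[OF c False] by (auto simp: pure_def)
qed simp

text \<open>
  The quadratic equations of \<open>u + w\<close> and \<open>u - w\<close> give a central linear combination of \<open>u\<close> and \<open>w\<close>.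
  Either its coefficients force the linear terms of the equations to vanish, or \<open>w = p * u + m\<close> with central
  \<open>p\<close>, \<open>m\<close>, where purity of \<open>w\<close> leaves only a multiple of \<open>u\<close>.
\<close>

lemma pure_jordan_central:
  assumes u: "pure u" and w: "pure w"
  shows "central (u * w + w * u)"
proof (cases "u = 0 \<or> w = 0")
  case True
  then show ?thesis by auto
next
  case nz: False
  have cu: "\<not> central u" and cw: "\<not> central w" and uu: "central (u * u)" and ww: "central (w * w)"
    using u w nz by (auto simp: pure_def)
  let ?s = "u * w + w * u"
  obtain a b where a: "central a" "central b" and ab: "(u + w) * (u + w) = a * (u + w) - b"
    by (rule quadratic)
  obtain c d where c: "central c" "central d" and cd: "(u - w) * (u - w) = c * (u - w) - d"
    by (rule quadratic)
  have s1: "?s = a * u + a * w - b - u * u - w * w"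
    using ab by (simp add: dist algebra_simps)
  have s2: "?s = u * u + w * w + d - (c * u - c * w)"
    using cd by (simp add: dist algebra_simps)
  define k where "k = b + d + (u * u + w * w) + (u * u + w * w)"
  have k: "central k" unfolding k_def by (intro central_add a c uu ww)
  have lin: "(a + c) * u + (a - c) * w = k"
    using s1 s2 unfolding k_def by (simp add: dist algebra_simps)
  show ?thesis
  proof (cases "a = c")
    case True
    then have "central ((a + a) * u)" using lin k by simp
    then have "a = 0"
      using central_cancel[of "a + a" u] central_add[OF a(1) a(1)] cu two by blast
    then show ?thesis
      unfolding s1 by (simp add: central_diff central_neg a uu ww)
  next
    case False
    obtain r where r: "central r" "(a - c) * r = e"
      using central_inverse[of "a - c"] central_diff[OF a(1) c(1)] False by auto
    define p where "p = - (r * (a + c))"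
    define m where "m = r * k"
    have p: "central p" and m: "central m"
      unfolding p_def m_def using r a c k by (simp_all add: central_mult central_add central_neg)
    have "w = r * ((a - c) * w)"
      using central_mult_left[OF r(1), of "a - c" w] r central_commutes[OF r(1), of "a - c"] by simp
    also have "(a - c) * w = k - (a + c) * u"
      using lin by (simp add: algebra_simps)
    finally have w_eq: "w = p * u + m"
      by (simp add: p_def m_def dist central_mult_left[OF r(1)])
    have "(p * u) * (p * u) = p * (p * (u * u))"
      by (simp add: central_mult_left[OF p] central_mult_right[OF p, of u])
    moreover have "m * (p * u) = (p * m) * u" "(p * u) * m = (p * m) * u"
      by (metis central_mult_left[OF m, of p u] central_commutes[OF m])+
    ultimately have "w * w = p * (p * (u * u)) + ((p * m + p * m) * u + m * m)"
      unfolding w_eq dist by (simp add: algebra_simps)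
    then have "(p * m + p * m) * u = w * w - p * (p * (u * u)) - m * m"
      by (simp add: algebra_simps)
    moreover have "central \<dots>"
      using ww uu p m by (simp add: central_diff central_mult)
    ultimately have "central ((p * m + p * m) * u)" by simp
    then have "p * m + p * m = 0"
      using central_cancel[of "p * m + p * m" u] cu central_add central_mult p m by blast
    then have "p = 0 \<or> m = 0" using two no_zero_divisors by blast
    then have "m = 0" using w_eq cw m by auto
    then have "?s = p * (u * u) + p * (u * u)"
      using w_eq by (simp add: central_mult_left[OF p] central_mult_right[OF p, of u])
    then show ?thesis using p uu by (simp add: central_add central_mult)
  qed
qed

lemma pure_add:
  assumes u: "pure u" and w: "pure w"
  shows "pure (u + w)"
  unfolding pure_def
proof
  have uu: "central (u * u)" and ww: "central (w * w)" using u w by (auto simp: pure_def)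
  have "(u + w) * (u + w) = (u * u + w * w) + (u * w + w * u)"
    by (simp add: dist algebra_simps)
  then show "central ((u + w) * (u + w))"
    using central_add[OF central_add[OF uu ww] pure_jordan_central[OF u w]] by simp
  show "central (u + w) \<longrightarrow> u + w = 0"
  proof
    assume f: "central (u + w)"
    define f where "f = u + w"
    have cf: "central f" using f by (simp add: f_def)
    have "w * w = (f - u) * (f - u)" by (simp add: f_def)
    also have "\<dots> = f * f - (f * u + f * u) + u * u"
      by (simp add: dist central_commutes[OF cf, of u] algebra_simps)
    finally have "(f + f) * u = f * f + u * u - w * w"
      by (simp add: dist algebra_simps)
    moreover have "central \<dots>" using cf uu ww by (simp add: central_diff central_add central_mult)
    ultimately have "f + f = 0 \<or> central u"
      using central_cancel[of "f + f" u] central_add[OF cf cf] by auto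
    then show "u + w = 0"
    proof
      assume "f + f = 0"
      then show ?thesis using two f_def by blast
    next
      assume "central u"
      then have "u = 0" using u by (simp add: pure_def)
      with f w show ?thesis by (simp add: pure_def)
    qed
  qed
qed

lemma pure_neg: "pure u \<Longrightarrow> pure (- u)"
  using pure_scale[OF central_neg[OF central_unit], of u] by (simp add: dist)

lemma pure_diff: "pure u \<Longrightarrow> pure w \<Longrightarrow> pure (u - w)"
  using pure_add[of u "- w"] pure_neg[of w] by simp

lemma pure_commutator:
  assumes u: "pure u" and w: "pure w"
  shows "pure (u * w - w * u)"
  unfolding pure_def
proof
  let ?c = "u * w - w * u"
  define s where "s = u * w + w * u"
  have uu: "central (u * u)" and ww: "central (w * w)" using u w by (auto simp: pure_def)
  have s: "central s" unfolding s_def by (rule pure_jordan_central[OF u w])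
  have wu: "w * u = s - u * w" by (simp add: s_def)
  have "(u * w) * (u * w) = u * (w * (u * w))"
    using associator_factor(1)[of u w w] unfolding type_associator_def by (simp add: alt_r)
  also have "w * (u * w) = (s - u * w) * w"
    unfolding wu[symmetric] by (simp add: flexible)
  also have "\<dots> = s * w - (w * w) * u"
    by (simp add: dist alt_r central_commutes[OF ww])
  also have "u * \<dots> = s * (u * w) - (w * w) * (u * u)"
    by (simp add: dist central_mult_right[OF s] central_mult_right[OF ww])
  finally have sq: "(u * w) * (u * w) = s * (u * w) - (w * w) * (u * u)" .
  have c_eq: "?c = (u * w + u * w) - s" by (simp add: s_def)
  have "?c * ?c = s * s - ((w * w) * (u * u) + (w * w) * (u * u) + ((w * w) * (u * u) + (w * w) * (u * u)))"
    unfolding c_eq dist sq central_commutes[OF s, of "u * w", symmetric] by (simp add: algebra_simps)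
  then show "central (?c * ?c)"
    using s uu ww by (simp add: central_diff central_add central_mult)
  show "central ?c \<longrightarrow> ?c = 0"
  proof
    assume c: "central ?c"
    have "?c * u + u * ?c = (u * w) * u - w * (u * u) + ((u * u) * w - u * (w * u))"
      by (simp add: dist alt_r flip: alt_l)
    also have "\<dots> = 0"
      by (simp add: flexible central_commutes[OF uu, of w])
    finally have "?c * u + ?c * u = 0" using central_commutes[OF c, of u] by simp
    then have "?c = 0 \<or> u = 0" using two no_zero_divisors by blast
    then show "?c = 0" by auto
  qed
qed

text \<open>
  Completing the square in the quadratic equation of \<open>x\<close>; uniqueness holds because pure elements form a
  subspace that meets the center in zero.
\<close>

lemma decomposition: "\<exists>!a. central a \<and> pure (x - a)" for x :: 'a
proof -
  obtain h :: 'a where h: "central h" "\<And>x :: 'a. h * x + h * x = x" using half by blast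
  obtain t n where tn: "central t" "central n" "x * x = t * x - n" by (rule quadratic)
  have ht: "central (h * t)" using central_mult h tn by blast
  have "\<exists>a. central a \<and> pure (x - a)"
  proof (cases "central x")
    case True
    then show ?thesis by (intro exI[of _ x]) simp
  next
    case False
    have "(x - h * t) * (x - h * t) = x * x - ((h * t) * x + (h * t) * x) + (h * t) * (h * t)"
      by (simp add: dist central_commutes[OF ht, of x] algebra_simps)
    also have "\<dots> = (h * t) * (h * t) - n"
      unfolding tn(3) using h(2)[of "t * x"] by (simp add: central_mult_left[OF h(1)])
    finally have "central ((x - h * t) * (x - h * t))"
      using central_diff[OF central_mult[OF ht ht] tn(2)] by simp
    moreover have "\<not> central (x - h * t)"
      using False central_add[OF _ ht, of "x - h * t"] by auto
    ultimately show ?thesis using ht by (auto simp: pure_def)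
  qed
  moreover have "a = b" if "central a" "pure (x - a)" "central b" "pure (x - b)" for a b
  proof -
    have "pure (a - b)" using pure_diff[OF that(4,2)] by simp
    then show ?thesis using central_diff[OF that(1,3)] by (simp add: pure_def)
  qed
  ultimately show ?thesis by blast
qed

end

context central_division_domain
begin

definition re :: "'a \<Rightarrow> 'a"
  where "re x = (THE a. central a \<and> pure (x - a))"

lemma re_props: "central (re x)" "pure (x - re x)"
  using theI'[OF decomposition[of x]] by (simp_all add: re_def)

lemma re_eqI: "central a \<Longrightarrow> pure (x - a) \<Longrightarrow> re x = a"
  using decomposition[of x] re_props[of x] by blast

lemma re_central: "central a \<Longrightarrow> re a = a"
  by (rule re_eqI) simp_all

lemma re_add: "re (x + y) = re x + re y"
proof (rule re_eqI)
  show "central (re x + re y)" by (simp add: central_add re_props)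
  show "pure (x + y - (re x + re y))"
    using pure_add[OF re_props(2)[of x] re_props(2)[of y]] by (simp add: algebra_simps)
qed

lemma re_scale: "central c \<Longrightarrow> re (c * x) = c * re x"
  using pure_scale[OF _ re_props(2)[of x], of c]
  by (intro re_eqI) (simp_all add: central_mult re_props dist)

lemma pure_iff: "pure u \<longleftrightarrow> re u = 0"
  using re_props(2)[of u] re_eqI[of 0 u] by auto

definition conjugate :: "'a \<Rightarrow> 'a"
  where "conjugate x = re x + re x - x"

lemma conjugate_add: "conjugate (x + y) = conjugate x + conjugate y"
  by (simp add: conjugate_def re_add algebra_simps)

lemma conjugate_scale: "central c \<Longrightarrow> conjugate (c * x) = c * conjugate x"
  by (simp add: conjugate_def re_scale dist)

lemma conjugate_central: "central c \<Longrightarrow> conjugate c = c"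
  by (simp add: conjugate_def re_central)

lemma conjugate_pure: "pure u \<Longrightarrow> conjugate u = - u"
  by (simp add: conjugate_def pure_iff)

lemma conjugate_neg: "conjugate (- x) = - conjugate x"
  using conjugate_scale[OF central_neg[OF central_unit], of x] by (simp add: dist)

lemma conjugate_diff: "conjugate (x - y) = conjugate x - conjugate y"
  using conjugate_add[of x "- y"] by (simp add: conjugate_neg)

lemma decompose: obtains a u where "central a" "pure u" "x = a + u"
  using re_props[of x] that[of "re x" "x - re x"] by simp

text \<open>
  The product \<open>u * w\<close> is half of the central element \<open>u * w + w * u\<close> plus half of the pure element
  \<open>u * w - w * u\<close>. This is the only nontrivial case of conjugation being an anti-automorphism.
\<close>

lemma conjugate_pure_mult:
  assumes u: "pure u" and w: "pure w"
  shows "conjugate (u * w) = w * u"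
proof -
  obtain h :: 'a where h: "central h" "\<And>x :: 'a. h * x + h * x = x" using half by blast
  define s where "s = u * w + w * u"
  have s: "central s" unfolding s_def by (rule pure_jordan_central[OF u w])
  have "u * w - h * s = h * (u * w - w * u)"
    using h(2)[of "u * w"] by (simp add: s_def dist algebra_simps)
  then have "re (u * w) = h * s"
    using pure_scale[OF h(1) pure_commutator[OF u w]] central_mult[OF h(1) s] by (intro re_eqI) auto
  then show ?thesis
    using h(2)[of s] by (simp add: conjugate_def s_def)
qed

lemma conjugate_mult: "conjugate (x * y) = conjugate y * conjugate x"
proof -
  obtain a u where x: "central a" "pure u" "x = a + u" by (rule decompose)
  obtain b w where y: "central b" "pure w" "y = b + w" by (rule decompose)
  have "x * y = a * b + a * w + b * u + u * w"
    by (simp add: x(3) y(3) dist central_commutes[OF y(1), of u] algebra_simps)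
  then have "conjugate (x * y) = a * b - a * w - b * u + w * u"
    using x y by (simp add: conjugate_add conjugate_central conjugate_scale conjugate_pure central_mult conjugate_pure_mult mult_neg)
  also have "\<dots> = conjugate y * conjugate x"
    using x y by (simp add: conjugate_add conjugate_central conjugate_pure dist central_commutes[OF x(1), of b]
      central_commutes[OF x(1), of w] algebra_simps)
  finally show ?thesis .
qed

definition norm_form :: "'a \<Rightarrow> 'a"
  where "norm_form x = x * conjugate x"

lemma norm_form_central: "central (norm_form x)"
proof -
  obtain a u where x: "central a" "pure u" "x = a + u" by (rule decompose)
  have "norm_form x = a * a - u * u"
    using x by (simp add: norm_form_def conjugate_add conjugate_central conjugate_pure dist central_commutes[OF x(1), of u])
  then show ?thesis
    using x by (simp add: central_diff central_mult pure_def)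
qed

lemma conjugate_mult_self: "conjugate x * x = norm_form x"
  by (simp add: norm_form_def conjugate_def dist central_commutes[OF re_props(1), of x x])

lemma associator_conj: "\<langle>x, y, conjugate z\<rangle> = - \<langle>x, y, z\<rangle>"
  by (simp add: conjugate_def associator_lin central_associator[OF re_props(1)])

text \<open>
  \<open>(x y)(conj y conj x) = ((x y) conj y) conj x = (x (y conj y)) conj x\<close>, because
  conjugates differ from negatives by central elements: the associators that occur are, up to sign,
  those of \<open>(x y, y, x)\<close> and \<open>(x, y, y)\<close>, which vanish.
\<close>

lemma norm_form_mult: "norm_form (x * y) = norm_form x * norm_form y"
proof -
  have 1: "\<langle>x * y, conjugate y, conjugate x\<rangle> = 0"
    using associator_mult_left(1)[of x y y]
    by (simp add: associator_conj associator_swap23[of "x * y" "conjugate y" x])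
  have "\<langle>x, y, conjugate y\<rangle> = 0" by (simp add: associator_conj)
  then have 2: "(x * y) * conjugate y = x * norm_form y"
    by (simp add: type_associator_def norm_form_def)
  have "norm_form (x * y) = (x * norm_form y) * conjugate x"
    using 1 unfolding norm_form_def[of "x * y"] conjugate_mult 2[symmetric] by (simp add: type_associator_def)
  also have "\<dots> = norm_form y * norm_form x"
    unfolding central_commutes[OF norm_form_central[of y], of x, symmetric]
      central_mult_left[OF norm_form_central] norm_form_def[of x] ..
  also have "\<dots> = norm_form x * norm_form y"
    by (rule central_commutes[OF norm_form_central])
  finally show ?thesis .
qed

lemma norm_form_zero_iff: "norm_form x = 0 \<longleftrightarrow> x = 0"
proof
  assume "norm_form x = 0"
  then have "x = 0 \<or> conjugate x = 0" using no_zero_divisors by (auto simp: norm_form_def)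
  moreover have "conjugate (conjugate x) = x"
    by (simp add: conjugate_def[of x] conjugate_diff conjugate_add conjugate_central re_props)
  moreover have "conjugate 0 = 0" by (simp add: conjugate_central)
  ultimately show "x = 0" by metis
qed (simp add: norm_form_def)

lemma inverse_exists:
  assumes "x \<noteq> 0"
  shows "\<exists>y. x * y = e \<and> y * x = e"
proof -
  obtain d where d: "central d" "norm_form x * d = e"
    using central_inverse[OF norm_form_central[of x]] assms norm_form_zero_iff by blast
  have "x * (d * conjugate x) = e" "(d * conjugate x) * x = e"
    using d(2) central_commutes[OF d(1), of "norm_form x"]
    by (simp_all add: central_mult_left[OF d(1)] central_mult_right[OF d(1), of x] conjugate_mult_self flip: norm_form_def)
  then show ?thesis by blast
qed

definition polar :: "'a \<Rightarrow> 'a \<Rightarrow> 'a"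
  where "polar x y = norm_form (x + y) - norm_form x - norm_form y"

lemma polar_eq: "polar x y = x * conjugate y + y * conjugate x"
  by (simp add: polar_def norm_form_def conjugate_add dist algebra_simps)

lemma polar_central: "central (polar x y)"
  by (simp add: polar_def central_diff norm_form_central)

lemma polar_sym: "polar x y = polar y x"
  by (simp add: polar_def algebra_simps)

lemma polar_add: "polar (x + y) z = polar x z + polar y z" "polar z (x + y) = polar z x + polar z y"
  by (simp_all add: polar_eq conjugate_add dist algebra_simps)

lemma polar_diff: "polar (x - y) z = polar x z - polar y z" "polar z (x - y) = polar z x - polar z y"
  by (simp_all add: polar_eq conjugate_diff dist algebra_simps)

lemma polar_neg: "polar (- x) z = - polar x z" "polar z (- x) = - polar z x"
  by (simp_all add: polar_eq conjugate_neg dist algebra_simps)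

lemma polar_scale: "central c \<Longrightarrow> polar (c * x) y = c * polar x y" "central c \<Longrightarrow> polar x (c * y) = c * polar x y"
  by (simp_all add: polar_eq conjugate_scale dist central_mult_left central_mult_right)

lemma polar_self: "polar x x = norm_form x + norm_form x"
  by (simp add: polar_eq norm_form_def)

lemma polar_self_zero: "polar x x = 0 \<Longrightarrow> x = 0"
  using two norm_form_zero_iff by (metis polar_self)

lemma norm_form_of_central: "central c \<Longrightarrow> norm_form c = c * c"
  by (simp add: norm_form_def conjugate_central)

lemma polar_mult_right: "polar (x * z) (y * z) = polar x y * norm_form z"
  by (simp add: polar_def norm_form_mult dist flip: dist_r)

lemma polar_mult_left: "polar (z * x) (z * y) = norm_form z * polar x y"
  by (simp add: polar_def norm_form_mult dist flip: dist_l)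


section \<open>An orthogonal frame of eight elements\<close>

lemma polar_unit_pure: "polar e u = 0 \<longleftrightarrow> pure u"
proof -
  have "polar e u = re u + re u"
    by (simp add: polar_eq conjugate_central) (simp add: conjugate_def)
  then show ?thesis using two pure_iff by (metis add_0)
qed

lemma pure_square: "pure u \<Longrightarrow> u * u = - norm_form u"
  by (simp add: norm_form_def conjugate_pure mult_neg)

lemma anticommute:
  assumes "pure u" "pure w" "polar u w = 0"
  shows "u * w = - (w * u)"
  using assms by (simp add: polar_eq conjugate_pure mult_neg) (metis minus_minus)

lemma polar_mult_cancel: "x \<noteq> 0 \<Longrightarrow> polar (x * y) (x * z) = 0 \<longleftrightarrow> polar y z = 0"
  using no_zero_divisors norm_form_zero_iff by (force simp: polar_mult_left)

lemma orthogonal_shift: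
  assumes "polar f f \<noteq> 0"
  shows "\<exists>c. central c \<and> polar (x - c * f) f = 0"
proof -
  obtain d where d: "central d" "polar f f * d = e"
    using central_inverse[OF polar_central assms] by blast
  have "polar (x - (polar x f * d) * f) f = 0"
    using d central_commutes[OF d(1), of "polar f f"]
    by (simp add: polar_diff polar_scale central_mult polar_central central_mult_left[OF polar_central])
  then show ?thesis using central_mult[OF polar_central d(1)] by blast
qed

text \<open>
  An element \<open>r\<close> that anticommutes with \<open>p\<close>, \<open>q\<close> and \<open>p * q\<close> acts like the new generator of a Cayley-Dickson
  doubling: reassociating with it costs a sign.
\<close>

lemma anticommuting_assoc:
  fixes p q r :: 'a
  assumes rp: "r * p = - (p * r)" and qr: "q * r = - (r * q)" and pqr: "(p * q) * r = - (r * (p * q))"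
  shows "p * (q * r) = - ((p * q) * r)"
proof -
  have "\<langle>p, r, q\<rangle> + \<langle>r, p, q\<rangle> = 0" by (simp add: associator_swap12[of r p])
  then show ?thesis
    using rp by (simp add: type_associator_def qr pqr dist algebra_simps)
qed

text \<open>
  Orthogonalizing the entries of a nonzero associator does not change the associator, and produces
  \<open>i\<close>, \<open>j\<close>, \<open>l\<close> such that \<open>e, i, j, i * j\<close> and their products with \<open>l\<close> are orthogonal. If a nonzero \<open>m\<close> were
  orthogonal to all eight, a further doubling would be possible, and the sign rule above, applied to
  \<open>i\<close>, \<open>j\<close>, \<open>l\<close>, \<open>m\<close> in two ways, would give \<open>(i * j) * (l * m) = - ((i * j) * (l * m))\<close>. This is the reason
  why the construction stops at dimension eight.
\<close>

theorem octonion_basis: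
  "\<exists>B :: 'a set. card B = 8 \<and> 0 \<notin> B \<and> (\<forall>f\<in>B. \<forall>g\<in>B. f \<noteq> g \<longrightarrow> polar f g = 0) \<and>
    (\<forall>x. (\<forall>f\<in>B. polar x f = 0) \<longrightarrow> x = 0)"
proof -
  obtain x y z :: 'a where xyz: "\<langle>x, y, z\<rangle> \<noteq> 0" using proper by blast
  have pe: "polar e e \<noteq> 0" using polar_self_zero unit_nonzero by blast
  obtain c where c: "central c" "polar (x - c * e) e = 0" using orthogonal_shift[OF pe] by blast
  define i where "i = x - c * e"
  have ei: "polar e i = 0" using c polar_sym by (simp add: i_def)
  have a1: "\<langle>i, y, z\<rangle> = \<langle>x, y, z\<rangle>" by (simp add: i_def associator_lin central_associator[OF c(1)])
  have i0: "i \<noteq> 0" using a1 xyz by auto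
  have pi: "polar i i \<noteq> 0" using polar_self_zero i0 by blast
  obtain c where c: "central c" "polar (y - c * e) e = 0" using orthogonal_shift[OF pe] by blast
  obtain d where d: "central d" "polar ((y - c * e) - d * i) i = 0" using orthogonal_shift[OF pi] by blast
  define j where "j = (y - c * e) - d * i"
  have ej: "polar e j = 0" using c(2) d(1) ei polar_sym[of e] by (simp add: j_def polar_diff polar_scale)
  have ij: "polar i j = 0" using d(2) polar_sym[of i] by (simp add: j_def)
  have a2: "\<langle>i, j, z\<rangle> = \<langle>x, y, z\<rangle>"
    using a1 by (simp add: j_def associator_lin central_associator[OF c(1)] central_scale_associator[OF d(1)])
  have j0: "j \<noteq> 0" using a2 xyz by auto
  have pj: "polar j j \<noteq> 0" using polar_self_zero j0 by blast
  have pure_ij: "pure i" "pure j" using ei ej polar_unit_pure by blast+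
  define k where "k = i * j"
  have k0: "k \<noteq> 0" using no_zero_divisors i0 j0 by (auto simp: k_def)
  have pk: "polar k k \<noteq> 0" using polar_self_zero k0 by blast
  define p where "p = norm_form i"
  define q where "q = norm_form j"
  have pq: "central p" "central q" by (simp_all add: p_def q_def norm_form_central)
  have ii: "i * i = - p" and jj: "j * j = - q"
    using pure_square pure_ij by (simp_all add: p_def q_def)
  have ji: "j * i = - k" using anticommute[OF pure_ij(2,1)] ij polar_sym[of i] by (simp add: k_def)
  have ik: "i * k = - (p * j)" and kj: "k * j = - (q * i)"
    using alt_l[of i j] alt_r[of i j] ii jj central_commutes[OF pq(2), of i] by (simp_all add: k_def dist)
  have ki: "k * i = p * j" and jk: "j * k = q * i"
    using alt_r[of j i] alt_l[of j i] ii jj central_commutes[OF pq(1), of j] unfolding ji by (simp_all add: dist)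
  have ek: "polar e k = 0"
    using polar_mult_cancel[OF i0, of e k] ik ij by (simp add: polar_neg polar_scale pq)
  have ik': "polar i k = 0" using polar_mult_cancel[OF i0, of e j] ej by (simp add: k_def)
  have jk': "polar j k = 0" using polar_mult_right[of e j i] ei by (simp add: k_def)
  have pure_k: "pure k" using ek polar_unit_pure by blast
  have kk: "k * k = - norm_form k" using pure_square pure_k by blast

  obtain c1 where c1: "central c1" "polar (z - c1 * e) e = 0" using orthogonal_shift[OF pe] by blast
  define z1 where "z1 = z - c1 * e"
  obtain c2 where c2: "central c2" "polar (z1 - c2 * i) i = 0" using orthogonal_shift[OF pi] by blast
  define z2 where "z2 = z1 - c2 * i"
  obtain c3 where c3: "central c3" "polar (z2 - c3 * j) j = 0" using orthogonal_shift[OF pj] by blast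
  define z3 where "z3 = z2 - c3 * j"
  obtain c4 where c4: "central c4" "polar (z3 - c4 * k) k = 0" using orthogonal_shift[OF pk] by blast
  define l where "l = z3 - c4 * k"
  have lk: "polar l k = 0" using c4 by (simp add: l_def)
  have lj: "polar l j = 0"
    using c3(2) c4(1) polar_sym[of k j] jk' by (simp add: l_def z3_def polar_diff polar_scale)
  have li: "polar l i = 0"
    using c2(2) c3(1) c4(1) polar_sym[of k i] ik' polar_sym[of j i] ij
    by (simp add: l_def z3_def z2_def polar_diff polar_scale)
  have le: "polar l e = 0"
    using c1(2) c2(1) c3(1) c4(1) polar_sym[of _ e] ek ei ej
    by (simp add: l_def z3_def z2_def z1_def polar_diff polar_scale)
  have a3: "\<langle>i, j, l\<rangle> = \<langle>x, y, z\<rangle>"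
    unfolding l_def z3_def z2_def z1_def k_def
    by (simp add: associator_lin central_associator c1(1) central_scale_associator c2(1) c3(1) c4(1) associator_factor a2)
  have l0: "l \<noteq> 0" using a3 xyz by auto
  have pure_l: "pure l" using le polar_sym polar_unit_pure by metis

  define H where "H = {e, i, j, k}"
  define B where "B = H \<union> (\<lambda>h. h * l) ` H"
  have H0: "h \<noteq> 0" if "h \<in> H" for h
    using that i0 j0 k0 by (auto simp: H_def)
  have HH: "polar f g = 0" if "f \<in> H" "g \<in> H" "f \<noteq> g" for f g
    using that ei ej ek ij ik' jk' polar_sym by (auto simp: H_def)
  have lH: "polar l (f * g) = 0" if "f \<in> H" "g \<in> H" for f g
    using that le li lj lk k_def[symmetric] ii jj kk ji ik kj ki jk
      polar_scale(2)[of _ l e] norm_form_central[of k]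
    by (auto simp: H_def polar_neg polar_scale pq) 
  have HlH: "polar (f * l) g = 0" if f: "f \<in> H" and g: "g \<in> H" for f g
  proof -
    have "central (f * f)"
      using f pq norm_form_central[of k] by (auto simp: H_def ii jj kk central_neg)
    then have "polar (f * (f * l)) (f * g) = 0"
      using lH[OF f g] by (simp add: polar_scale flip: alt_l)
    then show ?thesis using polar_mult_cancel H0[OF f] by blast
  qed
  have HlHl: "polar (f * l) (g * l) = 0" if "f \<in> H" "g \<in> H" "f * l \<noteq> g * l" for f g
    using HH[OF that(1,2)] that(3) by (cases "f = g") (simp_all add: polar_mult_right)
  have orth: "polar f g = 0" if "f \<in> B" "g \<in> B" "f \<noteq> g" for f g
  proof -
    from that(1,2) consider "f \<in> H" "g \<in> H" | h where "h \<in> H" "f = h * l" "g \<in> H"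
      | h where "f \<in> H" "h \<in> H" "g = h * l" | h h' where "h \<in> H" "f = h * l" "h' \<in> H" "g = h' * l"
      unfolding B_def by blast
    then show ?thesis
    proof cases
      case 1 then show ?thesis using HH that(3) by blast
    next
      case 2 then show ?thesis using HlH by blast
    next
      case 3 then show ?thesis using HlH polar_sym[of f] by simp
    next
      case 4 then show ?thesis using HlHl that(3) by blast
    qed
  qed
  have "card H = 4"
  proof -
    have "e \<noteq> i" "e \<noteq> j" "e \<noteq> k" "i \<noteq> j" "i \<noteq> k" "j \<noteq> k"
      using ei ej ek ij ik' jk' pe pi pj by metis+
    then show ?thesis by (simp add: H_def)
  qed
  moreover have "inj_on (\<lambda>h. h * l) H"
  proof (rule inj_onI)
    fix f g assume "f * l = g * l"
    then have "(f - g) * l = 0" by (simp add: dist)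
    then show "f = g" using no_zero_divisors l0 by fastforce
  qed
  moreover have "H \<inter> (\<lambda>h. h * l) ` H = {}"
  proof (rule equals0I)
    fix g assume "g \<in> H \<inter> (\<lambda>h. h * l) ` H"
    then obtain f where "f \<in> H" "g \<in> H" "g = f * l" by blast
    then have "polar g g = 0" using HlH[of f g] by simp
    with H0[OF \<open>g \<in> H\<close>] show False using polar_self_zero by blast
  qed
  ultimately have "card B = 8"
    using card_Un_disjoint[of H "(\<lambda>h. h * l) ` H"] by (simp add: B_def card_image) (simp add: H_def)
  moreover have "m = 0" if m: "\<forall>f\<in>B. polar m f = 0" for m
  proof (rule ccontr)
    assume m0: "m \<noteq> 0"
    have pure_m: "pure m"
      using m polar_sym polar_unit_pure by (auto simp: B_def H_def)
    have pure_hl: "pure (h * l)" if "h \<in> H" for h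
      using HlH[OF that, of e] polar_sym polar_unit_pure by (auto simp: H_def)
    have anti_m: "f * m = - (m * f)" "m * f = - (f * m)" if "f \<in> {i, j, k, l, i * l, j * l, k * l}" for f
    proof -
      have "pure f" using that pure_ij pure_k pure_l pure_hl by (auto simp: H_def)
      moreover have "f \<in> B" using that by (auto simp: B_def H_def image_iff)
      ultimately have "m * f = - (f * m)"
        using m anticommute[OF pure_m] by blast
      then show "f * m = - (m * f)" "m * f = - (f * m)" by simp_all
    qed
    have anti_l: "h * l = - (l * h)" "l * h = - (h * l)" if "h \<in> {i, j, k}" for h
    proof -
      have "l * h = - (h * l)"
        using that li lj lk pure_ij pure_k by (intro anticommute[OF pure_l]) auto
      then show "h * l = - (l * h)" "l * h = - (h * l)" by simp_all
    qed
    have kl: "i * (j * l) = - (k * l)"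
      unfolding k_def
      by (rule anticommuting_assoc[OF anti_l(2) anti_l(1) anti_l(1)[of k, unfolded k_def]])
        (simp_all add: k_def)
    have hlm: "h * (l * m) = - ((h * l) * m)" "h * (l * m) = - ((l * m) * h)" if h: "h \<in> {i, j, k}" for h
    proof -
      show 1: "h * (l * m) = - ((h * l) * m)"
        using h by (intro anticommuting_assoc anti_m) auto
      have mh: "m * h = - (h * m)" and lh: "l * h = - (h * l)"
        using h by (auto intro!: anti_m(2) anti_l(2))
      have "\<langle>l, m, h\<rangle> = - \<langle>l, h, m\<rangle>" by (rule associator_swap23)
      then have "(l * m) * h = (h * l) * m"
        unfolding type_associator_def mh lh dist by (simp add: algebra_simps)
      with 1 show "h * (l * m) = - ((l * m) * h)" by simp
    qed
    \<comment> \<open>First evaluation of \<open>i * (j * (l * m))\<close>: split off \<open>m\<close>, so that the remaining product only involves \<open>i\<close>, \<open>j\<close> and \<open>l\<close>.\<close>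
    have "i * ((j * l) * m) = - ((i * (j * l)) * m)"
    proof (rule anticommuting_assoc)
      show "m * i = - (i * m)" "(j * l) * m = - (m * (j * l))"
        by (auto intro!: anti_m)
      show "(i * (j * l)) * m = - (m * (i * (j * l)))"
        unfolding kl dist by (subst anti_m(1)) auto
    qed
    then have "i * (j * (l * m)) = k * (l * m)"
      using hlm(1)[of j] hlm(1)[of k] by (simp add: kl dist)
    \<comment> \<open>Second evaluation: treat \<open>l * m\<close> as a single element anticommuting with \<open>i\<close>, \<open>j\<close> and \<open>k\<close>.\<close>
    moreover have "i * (j * (l * m)) = - (k * (l * m))"
      unfolding k_def
      by (rule anticommuting_assoc) (use hlm(2)[of i] hlm(2)[of j] hlm(2)[of k] in \<open>simp_all add: k_def\<close>)
    ultimately have "k * (l * m) + k * (l * m) = 0" by (metis add.right_inverse)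
    then have "k * (l * m) = 0" by (rule two)
    then show False using no_zero_divisors k0 l0 m0 by blast
  qed
  moreover have "0 \<notin> B"
    using H0 l0 no_zero_divisors[of _ l] by (force simp: B_def)
  ultimately show ?thesis using orth by blast
qed

end

section \<open>From types to carrier sets\<close>

definition domain_like :: "('a, 'm) ring_scheme \<Rightarrow> bool" where
  "domain_like R \<longleftrightarrow> (\<forall>x\<in>carrier R. \<forall>y\<in>carrier R. x \<otimes>\<^bsub>R\<^esub> y = \<zero>\<^bsub>R\<^esub> \<longrightarrow> x = \<zero>\<^bsub>R\<^esub> \<or> y = \<zero>\<^bsub>R\<^esub>)"

definition regular_associators :: "('a, 'm) ring_scheme \<Rightarrow> bool" where
  "regular_associators R \<longleftrightarrow> (\<forall>x\<in>carrier R. \<forall>y\<in>carrier R. \<forall>z\<in>carrier R. \<forall>u\<in>carrier R.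
     associator R x y z \<otimes>\<^bsub>R\<^esub> u = \<zero>\<^bsub>R\<^esub> \<or> u \<otimes>\<^bsub>R\<^esub> associator R x y z = \<zero>\<^bsub>R\<^esub> \<longrightarrow>
     associator R x y z = \<zero>\<^bsub>R\<^esub> \<or> u = \<zero>\<^bsub>R\<^esub>)"

definition not_char_two :: "('a, 'm) ring_scheme \<Rightarrow> bool" where
  "not_char_two R \<longleftrightarrow> (\<exists>x\<in>carrier R. x \<oplus>\<^bsub>R\<^esub> x \<noteq> \<zero>\<^bsub>R\<^esub>)"

definition central_division :: "('a, 'm) ring_scheme \<Rightarrow> bool" where
  "central_division R \<longleftrightarrow> \<one>\<^bsub>R\<^esub> \<in> carrier R \<and>
    (\<forall>x\<in>carrier R. \<one>\<^bsub>R\<^esub> \<otimes>\<^bsub>R\<^esub> x = x \<and> x \<otimes>\<^bsub>R\<^esub> \<one>\<^bsub>R\<^esub> = x) \<and>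
    (\<forall>c\<in>ring_center R. c \<noteq> \<zero>\<^bsub>R\<^esub> \<longrightarrow> (\<exists>d\<in>ring_center R. c \<otimes>\<^bsub>R\<^esub> d = \<one>\<^bsub>R\<^esub>))"

definition polar_in :: "('a, 'm) ring_scheme \<Rightarrow> ('a \<Rightarrow> 'a) \<Rightarrow> 'a \<Rightarrow> 'a \<Rightarrow> 'a" where
  "polar_in R q x y = q (x \<oplus>\<^bsub>R\<^esub> y) \<ominus>\<^bsub>R\<^esub> q x \<ominus>\<^bsub>R\<^esub> q y"

definition central_norm :: "('a, 'm) ring_scheme \<Rightarrow> ('a \<Rightarrow> 'a) \<Rightarrow> bool" where
  "central_norm R q \<longleftrightarrow> (\<forall>x\<in>carrier R. q x \<in> ring_center R) \<and>
    (\<forall>x\<in>carrier R. q x = \<zero>\<^bsub>R\<^esub> \<longrightarrow> x = \<zero>\<^bsub>R\<^esub>) \<and>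
    (\<forall>x\<in>carrier R. \<forall>y\<in>carrier R. q (x \<otimes>\<^bsub>R\<^esub> y) = q x \<otimes>\<^bsub>R\<^esub> q y) \<and>
    (\<forall>c\<in>ring_center R. \<forall>x\<in>carrier R. q (c \<otimes>\<^bsub>R\<^esub> x) = (c \<otimes>\<^bsub>R\<^esub> c) \<otimes>\<^bsub>R\<^esub> q x) \<and>
    (\<forall>x\<in>carrier R. polar_in R q x x = q x \<oplus>\<^bsub>R\<^esub> q x) \<and>
    (\<forall>x\<in>carrier R. \<forall>y\<in>carrier R. \<forall>z\<in>carrier R.
      polar_in R q (x \<oplus>\<^bsub>R\<^esub> y) z = polar_in R q x z \<oplus>\<^bsub>R\<^esub> polar_in R q y z) \<and>
    (\<forall>c\<in>ring_center R. \<forall>x\<in>carrier R. \<forall>y\<in>carrier R.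
      polar_in R q (c \<otimes>\<^bsub>R\<^esub> x) y = c \<otimes>\<^bsub>R\<^esub> polar_in R q x y)"

definition orthogonal_frame :: "('a, 'm) ring_scheme \<Rightarrow> ('a \<Rightarrow> 'a) \<Rightarrow> 'a set \<Rightarrow> bool" where
  "orthogonal_frame R q B \<longleftrightarrow> B \<subseteq> carrier R \<and> \<zero>\<^bsub>R\<^esub> \<notin> B \<and>
    (\<forall>f\<in>B. \<forall>g\<in>B. f \<noteq> g \<longrightarrow> polar_in R q f g = \<zero>\<^bsub>R\<^esub>) \<and>
    (\<forall>x\<in>carrier R. (\<forall>f\<in>B. polar_in R q x f = \<zero>\<^bsub>R\<^esub>) \<longrightarrow> x = \<zero>\<^bsub>R\<^esub>)"

definition center_laws :: "('a, 'm) ring_scheme \<Rightarrow> bool" where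
  "center_laws R \<longleftrightarrow> \<zero>\<^bsub>R\<^esub> \<in> ring_center R \<and>
    (\<forall>c\<in>ring_center R. c \<in> carrier R \<and> \<ominus>\<^bsub>R\<^esub> c \<in> ring_center R \<and>
      (\<forall>d\<in>ring_center R. c \<oplus>\<^bsub>R\<^esub> d \<in> ring_center R \<and> c \<otimes>\<^bsub>R\<^esub> d \<in> ring_center R) \<and>
      (\<forall>x\<in>carrier R. c \<otimes>\<^bsub>R\<^esub> x = x \<otimes>\<^bsub>R\<^esub> c \<and>
        (\<forall>y\<in>carrier R. (c \<otimes>\<^bsub>R\<^esub> x) \<otimes>\<^bsub>R\<^esub> y = c \<otimes>\<^bsub>R\<^esub> (x \<otimes>\<^bsub>R\<^esub> y) \<and>
          x \<otimes>\<^bsub>R\<^esub> (c \<otimes>\<^bsub>R\<^esub> y) = c \<otimes>\<^bsub>R\<^esub> (x \<otimes>\<^bsub>R\<^esub> y))))"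

text \<open>
  Everything that the proof needs to know about an alternative ring with a carrier set. Each
  conjunct is the relativization of a result above. The statement is
  collected in one predicate so that it can be transferred in one stroke.
\<close>

definition structure_theorem :: "('a, 'm) ring_scheme \<Rightarrow> bool" where
  "structure_theorem R \<longleftrightarrow> center_laws R \<and>
    (\<not> associative_ring R \<longrightarrow> regular_associators R \<longrightarrow> domain_like R) \<and>
    (\<not> associative_ring R \<longrightarrow> domain_like R \<longrightarrow> not_char_two R \<longrightarrow>
      (\<exists>c\<in>ring_center R. c \<noteq> \<zero>\<^bsub>R\<^esub>) \<and>
      (central_division R \<longrightarrow>
        (\<forall>x\<in>carrier R. x \<noteq> \<zero>\<^bsub>R\<^esub> \<longrightarrow> (\<exists>y\<in>carrier R. x \<otimes>\<^bsub>R\<^esub> y = \<one>\<^bsub>R\<^esub> \<and> y \<otimes>\<^bsub>R\<^esub> x = \<one>\<^bsub>R\<^esub>)) \<and>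
        (\<exists>q B. central_norm R q \<and> orthogonal_frame R q B \<and> card B = 8)))"

lemma trivial_alternative_ring:
  "alternative_ring \<lparr>carrier = {a}, mult = (\<lambda>_ _. a), one = a, zero = a, add = (\<lambda>_ _. a), \<dots> = m\<rparr>"
proof -
  let ?R = "\<lparr>carrier = {a}, mult = (\<lambda>_ _. a), one = a, zero = a, add = (\<lambda>_ _. a), \<dots> = m\<rparr>"
  have "abelian_group ?R" by (rule abelian_groupI) auto
  then interpret nonassoc_ring ?R
    by (intro nonassoc_ring.intro nonassoc_ring_axioms.intro) auto
  have "a \<ominus>\<^bsub>?R\<^esub> a = a" using minus_closed[of a a] by simp
  then show ?thesis
    by unfold_locales (auto simp: associator_def)
qed

text \<open>
  Type classes speak about whole types, while the rings in question live on subsets of a type. The gap is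
  bridged by a hypothetical counterexample: \<open>critical\<close> is an alternative ring that violates the structure
  theorem if any such ring on this type exists. It depends on type parameters only, so its
  carrier can be made a type. The results above then apply to that type, hence
  \<open>critical\<close> is no counterexample and there is none.
\<close>

definition critical :: "('a, 'm) ring_scheme" where
  "critical = (SOME R. alternative_ring R \<and>
    (structure_theorem R \<longrightarrow> (\<forall>S :: ('a, 'm) ring_scheme. alternative_ring S \<longrightarrow> structure_theorem S)))"

lemma critical:
  "alternative_ring (critical :: ('a, 'm) ring_scheme)"
  "structure_theorem (critical :: ('a, 'm) ring_scheme) \<Longrightarrow> alternative_ring (S :: ('a, 'm) ring_scheme) \<Longrightarrow>
    structure_theorem S"
proof -
  have "\<exists>R :: ('a, 'm) ring_scheme. alternative_ring R \<and>
    (structure_theorem R \<longrightarrow> (\<forall>S :: ('a, 'm) ring_scheme. alternative_ring S \<longrightarrow> structure_theorem S))"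
  proof (cases "\<forall>S :: ('a, 'm) ring_scheme. alternative_ring S \<longrightarrow> structure_theorem S")
    case True
    then show ?thesis using trivial_alternative_ring by (intro exI conjI) auto
  qed blast
  from someI_ex[OF this, folded critical_def]
  show "alternative_ring (critical :: ('a, 'm) ring_scheme)"
    "structure_theorem (critical :: ('a, 'm) ring_scheme) \<Longrightarrow> alternative_ring S \<Longrightarrow> structure_theorem S"
    by blast+
qed

interpretation critical: alternative_ring critical
  by (rule critical)

typedef ('a, 'm) element = "carrier (critical :: ('a, 'm) ring_scheme)"
  by (rule exI, rule critical.zero_closed)

lemma carrier_critical: "carrier (critical :: ('a, 'm) ring_scheme) = range (Rep_element :: ('a, 'm) element \<Rightarrow> 'a)"
  by (simp add: type_definition.Rep_range[OF type_definition_element])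

lemma Rep_in [simp]: "Rep_element (x :: ('a, 'm) element) \<in> carrier (critical :: ('a, 'm) ring_scheme)"
  by (rule Rep_element)

instantiation element :: (type, type) alt_ring
begin

definition zero_element :: "('a, 'b) element" where
  "0 = (Abs_element \<zero>\<^bsub>critical :: ('a, 'b) ring_scheme\<^esub> :: ('a, 'b) element)"
definition plus_element :: "('a, 'b) element \<Rightarrow> ('a, 'b) element \<Rightarrow> ('a, 'b) element" where
  "x + y = Abs_element (Rep_element x \<oplus>\<^bsub>critical :: ('a, 'b) ring_scheme\<^esub> Rep_element y)"
definition minus_element :: "('a, 'b) element \<Rightarrow> ('a, 'b) element \<Rightarrow> ('a, 'b) element" where
  "x - y = Abs_element (Rep_element x \<ominus>\<^bsub>critical :: ('a, 'b) ring_scheme\<^esub> Rep_element y)"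
definition uminus_element :: "('a, 'b) element \<Rightarrow> ('a, 'b) element" where
  "- y = Abs_element (\<ominus>\<^bsub>critical :: ('a, 'b) ring_scheme\<^esub> Rep_element y)"
definition times_element :: "('a, 'b) element \<Rightarrow> ('a, 'b) element \<Rightarrow> ('a, 'b) element" where
  "x * y = Abs_element (Rep_element x \<otimes>\<^bsub>critical :: ('a, 'b) ring_scheme\<^esub> Rep_element y)"

lemma Rep_ops:
  fixes x y :: "('a, 'b) element"
  shows "Rep_element (0 :: ('a, 'b) element) = \<zero>\<^bsub>critical :: ('a, 'b) ring_scheme\<^esub>"
    "Rep_element (x + y) = Rep_element x \<oplus>\<^bsub>critical :: ('a, 'b) ring_scheme\<^esub> Rep_element y"
    "Rep_element (x - y) = Rep_element x \<ominus>\<^bsub>critical :: ('a, 'b) ring_scheme\<^esub> Rep_element y"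
    "Rep_element (- y) = \<ominus>\<^bsub>critical :: ('a, 'b) ring_scheme\<^esub> Rep_element y"
    "Rep_element (x * y) = Rep_element x \<otimes>\<^bsub>critical :: ('a, 'b) ring_scheme\<^esub> Rep_element y"
  by (simp_all add: zero_element_def plus_element_def minus_element_def uminus_element_def
      times_element_def Abs_element_inverse critical.na_m_closed)

instance
proof
  fix x y z :: "('a, 'b) element"
  note lift = Rep_element_inject[symmetric] Rep_ops
  show "x + y + z = x + (y + z)"
    unfolding lift by (intro critical.a_assoc Rep_in)
  show "x + y = y + x"
    unfolding lift by (intro critical.a_comm Rep_in)
  show "0 + x = x"
    unfolding lift by (intro critical.l_zero Rep_in)
  show "- x + x = 0"
    unfolding lift by (intro critical.l_neg Rep_in)
  show "x - y = x + - y"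
    unfolding lift by (simp add: a_minus_def)
  show "(x + y) * z = x * z + y * z"
    unfolding lift by (intro critical.na_l_distr Rep_in)
  show "z * (x + y) = z * x + z * y"
    unfolding lift by (intro critical.na_r_distr Rep_in)
  show "(x * y) * y = x * (y * y)"
    unfolding lift using critical.right_alternative[OF Rep_in[of x] Rep_in[of y]]
    by (simp add: associator_def critical.na_m_closed)
  show "(y * y) * x = y * (y * x)"
    unfolding lift using critical.left_alternative[OF Rep_in[of x] Rep_in[of y]]
    by (simp add: associator_def critical.na_m_closed)
qed

end

lemma critical_ops:
  fixes x y z :: "('a, 'm) element"
  defines "C \<equiv> critical :: ('a, 'm) ring_scheme"
  shows "\<zero>\<^bsub>C\<^esub> = Rep_element (0 :: ('a, 'm) element)"
    "Rep_element x \<oplus>\<^bsub>C\<^esub> Rep_element y = Rep_element (x + y)"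
    "Rep_element x \<ominus>\<^bsub>C\<^esub> Rep_element y = Rep_element (x - y)"
    "\<ominus>\<^bsub>C\<^esub> Rep_element x = Rep_element (- x)"
    "Rep_element x \<otimes>\<^bsub>C\<^esub> Rep_element y = Rep_element (x * y)"
    "carrier C = range (Rep_element :: ('a, 'm) element \<Rightarrow> 'a)"
    "associator C (Rep_element x) (Rep_element y) (Rep_element z) = Rep_element \<langle>x, y, z\<rangle>"
    "commutator C (Rep_element x) (Rep_element y) = Rep_element \<lbrace>x, y\<rbrace>"
  unfolding C_def by (simp_all add: Rep_ops carrier_critical associator_def commutator_def type_associator_def type_commutator_def)

lemma ring_center_critical:
  "ring_center (critical :: ('a, 'm) ring_scheme) = Rep_element ` {c :: ('a, 'm) element. central c}"
proof -
  have "nucleus (critical :: ('a, 'm) ring_scheme) = Rep_element ` {c :: ('a, 'm) element. nuclear c}"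
    by (auto simp: nucleus_def nuclear_def critical_ops Rep_element_inject)
  then show ?thesis
    by (auto simp: ring_center_def central_def critical_ops Rep_element_inject)
qed

text \<open>
  The canonical bijection turns quantifiers over the carrier into quantifiers over the type and
  identifies associators, commutators and the center.
\<close>

lemma structure_theorem_critical: "structure_theorem (critical :: ('a, 'm) ring_scheme)"
proof -
  let ?C = "critical :: ('a, 'm) ring_scheme"
  note transfer = critical_ops ring_center_critical Rep_element_inject
  have assoc: "associative_ring ?C \<longleftrightarrow> \<not> (\<exists>p q r :: ('a, 'm) element. \<langle>p, q, r\<rangle> \<noteq> 0)"
    by (simp add: associative_ring_def transfer)
  have dom: "domain_like ?C \<longleftrightarrow> alternative_domain TYPE(('a, 'm) element)"
    by (simp add: domain_like_def alternative_domain_def transfer)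
  have 1: "domain_like ?C" if "\<not> associative_ring ?C" "regular_associators ?C"
    unfolding dom
  proof
    fix x y :: "('a, 'm) element"
    assume xy: "x * y = 0"
    show "x = 0 \<or> y = 0"
    proof (rule regular_associators_no_zero_divisors[OF _ _ xy])
      show "\<langle>x, y, z\<rangle> = 0 \<or> u = 0" if "\<langle>x, y, z\<rangle> * u = 0 \<or> u * \<langle>x, y, z\<rangle> = 0" for x y z u :: "('a, 'm) element"
      proof -
        have "\<forall>x y z u :: ('a, 'm) element. (\<langle>x, y, z\<rangle> * u = 0 \<or> u * \<langle>x, y, z\<rangle> = 0) \<longrightarrow> \<langle>x, y, z\<rangle> = 0 \<or> u = 0"
          using \<open>regular_associators ?C\<close> unfolding regular_associators_def by (simp add: transfer)
        with that show ?thesis by metis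
      qed
    qed (use that(1) assoc in blast)
  qed
  have 2: "(\<exists>c\<in>ring_center ?C. c \<noteq> \<zero>\<^bsub>?C\<^esub>) \<and>
      (central_division ?C \<longrightarrow>
        (\<forall>x\<in>carrier ?C. x \<noteq> \<zero>\<^bsub>?C\<^esub> \<longrightarrow> (\<exists>y\<in>carrier ?C. x \<otimes>\<^bsub>?C\<^esub> y = \<one>\<^bsub>?C\<^esub> \<and> y \<otimes>\<^bsub>?C\<^esub> x = \<one>\<^bsub>?C\<^esub>)) \<and>
        (\<exists>q B. central_norm ?C q \<and> orthogonal_frame ?C q B \<and> card B = 8))"
    if na: "\<not> associative_ring ?C" and d: "domain_like ?C" and two: "not_char_two ?C"
  proof -
    interpret alternative_domain "TYPE(('a, 'm) element)" using d dom by blast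
    obtain w :: "('a, 'm) element" where "w + w \<noteq> 0"
      using two by (auto simp: not_char_two_def transfer)
    then have two: "y = 0" if "y + y = 0" for y :: "('a, 'm) element"
      using two_torsion_free that by blast
    have proper: "\<exists>p q r :: ('a, 'm) element. \<langle>p, q, r\<rangle> \<noteq> 0"
      using na assoc by blast
    then obtain p :: "('a, 'm) element" where "\<not> nuclear p" by (auto simp: nuclear_def)
    from quadratic_equation[OF this two] obtain c :: "('a, 'm) element" where "central c" "c \<noteq> 0" by blast
    then have "\<exists>c\<in>ring_center ?C. c \<noteq> \<zero>\<^bsub>?C\<^esub>" by (auto simp: transfer)
    moreover have
      "(\<forall>x\<in>carrier ?C. x \<noteq> \<zero>\<^bsub>?C\<^esub> \<longrightarrow> (\<exists>y\<in>carrier ?C. x \<otimes>\<^bsub>?C\<^esub> y = \<one>\<^bsub>?C\<^esub> \<and> y \<otimes>\<^bsub>?C\<^esub> x = \<one>\<^bsub>?C\<^esub>)) \<and>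
        (\<exists>q B. central_norm ?C q \<and> orthogonal_frame ?C q B \<and> card B = 8)" if cd: "central_division ?C"
    proof -
      from cd have "\<one>\<^bsub>?C\<^esub> \<in> carrier ?C" by (simp add: central_division_def)
      then obtain e :: "('a, 'm) element" where e: "\<one>\<^bsub>?C\<^esub> = Rep_element e" by (auto simp: transfer)
      interpret central_division_domain "TYPE(('a, 'm) element)" e
      proof unfold_locales
        show "e * x = x" "x * e = x" for x
          using cd by (simp_all add: central_division_def transfer e)
        show "\<exists>d. central d \<and> c * d = e" if "central c" "c \<noteq> 0" for c
          using cd that by (simp add: central_division_def transfer e)
      qed (fact proper two)+
      define q where "q = (\<lambda>x. Rep_element (norm_form (Abs_element x)))"
      have q: "q (Rep_element x) = Rep_element (norm_form x)" for x
        by (simp add: q_def Rep_element_inverse)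
      have pol: "polar_in ?C q (Rep_element x) (Rep_element y) = Rep_element (polar x y)" for x y
        by (simp add: polar_in_def polar_def transfer q)
      have "central_norm ?C q"
        unfolding central_norm_def
        by (auto simp: transfer q pol norm_form_central norm_form_zero_iff norm_form_mult norm_form_of_central
            polar_self polar_add polar_scale)
      moreover obtain B :: "('a, 'm) element set" where B: "card B = 8" "0 \<notin> B"
        "\<forall>f\<in>B. \<forall>g\<in>B. f \<noteq> g \<longrightarrow> polar f g = 0" "\<forall>x. (\<forall>f\<in>B. polar x f = 0) \<longrightarrow> x = 0"
        using octonion_basis by blast
      have "orthogonal_frame ?C q (Rep_element ` B)"
        unfolding orthogonal_frame_def using B(2-4) by (auto simp: transfer pol)
      moreover have "card (Rep_element ` B) = 8"
        using B(1) by (subst card_image) (auto simp: inj_on_def Rep_element_inject)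
      moreover have "\<forall>x\<in>carrier ?C. x \<noteq> \<zero>\<^bsub>?C\<^esub> \<longrightarrow> (\<exists>y\<in>carrier ?C. x \<otimes>\<^bsub>?C\<^esub> y = \<one>\<^bsub>?C\<^esub> \<and> y \<otimes>\<^bsub>?C\<^esub> x = \<one>\<^bsub>?C\<^esub>)"
        using inverse_exists by (simp add: transfer e)
      ultimately show ?thesis by blast
    qed
    ultimately show ?thesis by blast
  qed
  have "c * x = x * c" if "central c" for c x :: "('a, 'm) element"
    using that by (rule central_commutes)
  then have "center_laws ?C"
    unfolding center_laws_def
    by (auto simp: transfer central_neg central_add central_mult central_mult_left central_mult_right)
  then show ?thesis
    unfolding structure_theorem_def using 1 2 by blast
qed

theorem alternative_structure: "alternative_ring R \<Longrightarrow> structure_theorem R"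
  by (rule critical(2)[OF structure_theorem_critical])

section \<open>The central quotient\<close>

lemma center_lawsD:
  assumes "alternative_ring R"
  shows "\<zero>\<^bsub>R\<^esub> \<in> ring_center R"
    "c \<in> ring_center R \<Longrightarrow> c \<in> carrier R"
    "c \<in> ring_center R \<Longrightarrow> \<ominus>\<^bsub>R\<^esub> c \<in> ring_center R"
    "c \<in> ring_center R \<Longrightarrow> d \<in> ring_center R \<Longrightarrow> c \<oplus>\<^bsub>R\<^esub> d \<in> ring_center R"
    "c \<in> ring_center R \<Longrightarrow> d \<in> ring_center R \<Longrightarrow> c \<otimes>\<^bsub>R\<^esub> d \<in> ring_center R"
    "c \<in> ring_center R \<Longrightarrow> x \<in> carrier R \<Longrightarrow> c \<otimes>\<^bsub>R\<^esub> x = x \<otimes>\<^bsub>R\<^esub> c"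
    "c \<in> ring_center R \<Longrightarrow> x \<in> carrier R \<Longrightarrow> y \<in> carrier R \<Longrightarrow> (c \<otimes>\<^bsub>R\<^esub> x) \<otimes>\<^bsub>R\<^esub> y = c \<otimes>\<^bsub>R\<^esub> (x \<otimes>\<^bsub>R\<^esub> y)"
    "c \<in> ring_center R \<Longrightarrow> x \<in> carrier R \<Longrightarrow> y \<in> carrier R \<Longrightarrow> x \<otimes>\<^bsub>R\<^esub> (c \<otimes>\<^bsub>R\<^esub> y) = c \<otimes>\<^bsub>R\<^esub> (x \<otimes>\<^bsub>R\<^esub> y)"
  using alternative_structure[OF assms] unfolding structure_theorem_def center_laws_def by blast+

lemma (in nonassoc_ring) zero_times [simp]: "x \<in> carrier R \<Longrightarrow> \<zero> \<otimes> x = \<zero>" "x \<in> carrier R \<Longrightarrow> x \<otimes> \<zero> = \<zero>"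
  using na_l_distr[of \<zero> \<zero> x] na_r_distr[of \<zero> \<zero> x] na_m_closed[of \<zero> x] na_m_closed[of x \<zero>]
    add.l_cancel_one'[of "\<zero> \<otimes> x" "\<zero> \<otimes> x"] add.l_cancel_one'[of "x \<otimes> \<zero>" "x \<otimes> \<zero>"]
  by simp_all

text \<open>
  The ring of fractions is formed at the level of carrier sets. Finitely many fractions
  have a common denominator, so every identity reduces to one in the original ring.
\<close>

locale central_localization = alternative_ring R for R (structure) +
  assumes domain: "domain_like R"
    and center_nonzero: "\<exists>c\<in>ring_center R. c \<noteq> \<zero>"
begin

abbreviation Z where "Z \<equiv> ring_center R"
abbreviation D where "D \<equiv> ring_center R - {\<zero>}"

lemmas laws = center_lawsD[OF alternative_ring_axioms]

lemma no_zd: "x \<otimes> y = \<zero> \<Longrightarrow> x \<in> carrier R \<Longrightarrow> y \<in> carrier R \<Longrightarrow> x = \<zero> \<or> y = \<zero>"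
  using domain by (auto simp: domain_like_def)

lemma scalar:
  assumes "c \<in> Z" "x \<in> carrier R" "y \<in> carrier R"
  shows "x \<otimes> (y \<otimes> c) = (x \<otimes> y) \<otimes> c" "(x \<otimes> c) \<otimes> y = (x \<otimes> y) \<otimes> c"
proof -
  have "x \<otimes> (y \<otimes> c) = c \<otimes> (x \<otimes> y)"
    using laws(8)[OF assms] laws(6)[OF assms(1,3)] by simp
  also have "\<dots> = (x \<otimes> y) \<otimes> c"
    using assms by (intro laws(6) na_m_closed)
  finally show "x \<otimes> (y \<otimes> c) = (x \<otimes> y) \<otimes> c" .
  have "(x \<otimes> c) \<otimes> y = c \<otimes> (x \<otimes> y)"
    using laws(7)[OF assms] laws(6)[OF assms(1,2)] by simp
  also have "\<dots> = (x \<otimes> y) \<otimes> c"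
    using assms by (intro laws(6) na_m_closed)
  finally show "(x \<otimes> c) \<otimes> y = (x \<otimes> y) \<otimes> c" .
qed

lemma cancel:
  assumes "c \<in> D" "x \<in> carrier R" "y \<in> carrier R" "x \<otimes> c = y \<otimes> c"
  shows "x = y"
proof -
  have c: "c \<in> carrier R" using assms(1) laws(2) by simp
  have "(x \<ominus> y) \<otimes> c \<oplus> y \<otimes> c = ((x \<ominus> y) \<oplus> y) \<otimes> c"
    using assms c by (intro na_l_distr[symmetric]) auto
  also have "(x \<ominus> y) \<oplus> y = x"
    using assms by (simp add: a_minus_def a_assoc l_neg)
  finally have "(x \<ominus> y) \<otimes> c = \<zero>"
    using assms c na_m_closed add.r_cancel_one[of "y \<otimes> c" "(x \<ominus> y) \<otimes> c"] by simp
  then have "x \<ominus> y = \<zero>" using no_zd[of "x \<ominus> y" c] assms c by auto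
  then show ?thesis using assms by simp
qed

lemma D_mult: "c \<in> D \<Longrightarrow> d \<in> D \<Longrightarrow> c \<otimes> d \<in> D"
  using laws(2)[of c] laws(2)[of d] laws(5)[of c d] no_zd[of c d] by auto

lemma D_carrier: "c \<in> D \<Longrightarrow> c \<in> carrier R"
  using laws(2) by simp

lemma frac_rel_iff: "((r, c), (s, d)) \<in> frac_rel R \<longleftrightarrow>
    r \<in> carrier R \<and> c \<in> D \<and> s \<in> carrier R \<and> d \<in> D \<and> r \<otimes> d = s \<otimes> c"
  by (auto simp: frac_rel_def frac_pairs_def)

lemma equiv_frac_rel: "equiv (frac_pairs R) (frac_rel R)"
proof (rule equivI)
  show "frac_rel R \<subseteq> frac_pairs R \<times> frac_pairs R" by (auto simp: frac_rel_def)
  show "refl_on (frac_pairs R) (frac_rel R)"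
    by (auto simp: refl_on_def frac_rel_def frac_pairs_def)
  show "sym (frac_rel R)"
    by (auto simp: sym_def frac_rel_iff)
  show "trans (frac_rel R)"
  proof (rule transI)
    fix p p' p''
    assume "(p, p') \<in> frac_rel R" "(p', p'') \<in> frac_rel R"
    then obtain r c r' c' r'' c'' where p: "p = (r, c)" "p' = (r', c')" "p'' = (r'', c'')"
      and in_R: "r \<in> carrier R" "r' \<in> carrier R" "r'' \<in> carrier R" and in_D: "c \<in> D" "c' \<in> D" "c'' \<in> D"
      and eq: "r \<otimes> c' = r' \<otimes> c" "r' \<otimes> c'' = r'' \<otimes> c'"
      by (cases p; cases p'; cases p'') (auto simp: frac_rel_iff)
    have Z: "c \<in> Z" "c' \<in> Z" "c'' \<in> Z" using in_D by auto
    note C = Z[THEN laws(2)]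
    have "(r \<otimes> c'') \<otimes> c' = (r \<otimes> c') \<otimes> c''" by (rule scalar(2)) (use Z C in_R in auto)
    also have "\<dots> = (r' \<otimes> c'') \<otimes> c" unfolding eq(1) by (rule scalar(2)) (use Z C in_R in auto)
    also have "\<dots> = (r'' \<otimes> c) \<otimes> c'" unfolding eq(2) by (rule scalar(2)) (use Z C in_R in auto)
    finally have "r \<otimes> c'' = r'' \<otimes> c"
      by (rule cancel[OF in_D(2), rotated 2]) (use C in_R na_m_closed in auto)
    then show "(p, p'') \<in> frac_rel R" using p in_R in_D by (simp add: frac_rel_iff)
  qed
qed

lemma scalar_interchange:
  assumes "c \<in> Z" "d \<in> Z" "x \<in> carrier R" "y \<in> carrier R"
  shows "(x \<otimes> y) \<otimes> (c \<otimes> d) = (x \<otimes> c) \<otimes> (y \<otimes> d)"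
proof -
  have cd: "c \<in> carrier R" "d \<in> carrier R" using assms laws(2) by blast+
  have "(x \<otimes> y) \<otimes> (c \<otimes> d) = ((x \<otimes> y) \<otimes> c) \<otimes> d"
    using assms cd by (intro scalar(1)) (auto simp: na_m_closed)
  also have "(x \<otimes> y) \<otimes> c = (x \<otimes> c) \<otimes> y"
    using assms by (intro scalar(2)[symmetric])
  also have "\<dots> \<otimes> d = (x \<otimes> c) \<otimes> (y \<otimes> d)"
    using assms cd by (intro scalar(1)[symmetric]) (auto simp: na_m_closed)
  finally show ?thesis .
qed

lemma pair_mult_cong:
  assumes "(p1, p2) \<in> frac_rel R" "(q1, q2) \<in> frac_rel R"
  shows "(pair_mult R p1 q1, pair_mult R p2 q2) \<in> frac_rel R"
proof -
  obtain r1 c1 r2 c2 where p: "p1 = (r1, c1)" "p2 = (r2, c2)" by (cases p1; cases p2)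
  obtain s1 d1 s2 d2 where q: "q1 = (s1, d1)" "q2 = (s2, d2)" by (cases q1; cases q2)
  note h = assms[unfolded p q frac_rel_iff]
  have "(r1 \<otimes> s1) \<otimes> (c2 \<otimes> d2) = (r2 \<otimes> s2) \<otimes> (c1 \<otimes> d1)"
    using h by (simp add: scalar_interchange)
  then show ?thesis
    using h D_mult[of c1 d1] D_mult[of c2 d2] by (simp add: p q pair_mult_def frac_rel_iff na_m_closed)
qed

lemma pair_add_cong:
  assumes "(p1, p2) \<in> frac_rel R" "(q1, q2) \<in> frac_rel R"
  shows "(pair_add R p1 q1, pair_add R p2 q2) \<in> frac_rel R"
proof -
  obtain r1 c1 r2 c2 where p: "p1 = (r1, c1)" "p2 = (r2, c2)" by (cases p1; cases p2)
  obtain s1 d1 s2 d2 where q: "q1 = (s1, d1)" "q2 = (s2, d2)" by (cases q1; cases q2)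
  have in_R: "r1 \<in> carrier R" "r2 \<in> carrier R" "s1 \<in> carrier R" "s2 \<in> carrier R"
    and in_D: "c1 \<in> D" "c2 \<in> D" "d1 \<in> D" "d2 \<in> D"
    and eqs: "r1 \<otimes> c2 = r2 \<otimes> c1" "s1 \<otimes> d2 = s2 \<otimes> d1"
    using assms by (simp_all add: p q frac_rel_iff)
  have Zs: "c1 \<in> Z" "c2 \<in> Z" "d1 \<in> Z" "d2 \<in> Z" using in_D by simp_all
  note C = Zs[THEN laws(2)]
  have 1: "(r1 \<otimes> d1) \<otimes> (c2 \<otimes> d2) = (r2 \<otimes> d2) \<otimes> (c1 \<otimes> d1)"
  proof -
    have "(r1 \<otimes> d1) \<otimes> (c2 \<otimes> d2) = (r1 \<otimes> c2) \<otimes> (d1 \<otimes> d2)"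
      by (intro scalar_interchange Zs in_R C)
    also have "\<dots> = (r2 \<otimes> c1) \<otimes> (d2 \<otimes> d1)" unfolding eqs(1) laws(6)[OF Zs(3) C(4)] ..
    also have "\<dots> = (r2 \<otimes> d2) \<otimes> (c1 \<otimes> d1)"
      by (intro scalar_interchange[symmetric] Zs in_R C)
    finally show ?thesis .
  qed
  have 2: "(s1 \<otimes> c1) \<otimes> (c2 \<otimes> d2) = (s2 \<otimes> c2) \<otimes> (c1 \<otimes> d1)"
  proof -
    have "(s1 \<otimes> c1) \<otimes> (c2 \<otimes> d2) = (s1 \<otimes> c1) \<otimes> (d2 \<otimes> c2)" unfolding laws(6)[OF Zs(2) C(4)] ..
    also have "\<dots> = (s1 \<otimes> d2) \<otimes> (c1 \<otimes> c2)"
      by (intro scalar_interchange Zs in_R C)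
    also have "\<dots> = (s2 \<otimes> d1) \<otimes> (c2 \<otimes> c1)" unfolding eqs(2) laws(6)[OF Zs(1) C(2)] ..
    also have "\<dots> = (s2 \<otimes> c2) \<otimes> (d1 \<otimes> c1)"
      by (intro scalar_interchange[symmetric] Zs in_R C)
    also have "d1 \<otimes> c1 = c1 \<otimes> d1" by (rule laws(6)[OF Zs(3) C(1)])
    finally show ?thesis .
  qed
  have "(r1 \<otimes> d1 \<oplus> s1 \<otimes> c1) \<otimes> (c2 \<otimes> d2) = (r2 \<otimes> d2 \<oplus> s2 \<otimes> c2) \<otimes> (c1 \<otimes> d1)"
    by (simp add: na_l_distr na_m_closed in_R C 1 2)
  then show ?thesis
    using D_mult[OF in_D(1,3)] D_mult[OF in_D(2,4)]
    by (simp add: p q pair_add_def frac_rel_iff na_m_closed in_R C)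
qed

lemma makes_sense: "central_quotient_makes_sense R"
  unfolding central_quotient_makes_sense_def
proof (intro conjI ballI)
  show "Z \<noteq> {\<zero>}" using center_nonzero by blast
  show "equiv (frac_pairs R) (frac_rel R)" by (rule equiv_frac_rel)
qed (auto intro: pair_add_cong pair_mult_cong)

definition Q where "Q = central_quotient R"

definition frac :: "'a \<Rightarrow> 'a \<Rightarrow> ('a \<times> 'a) set" where "frac r c = frac_class R (r, c)"

lemma frac_eq_iff:
  assumes "r \<in> carrier R" "c \<in> D" "s \<in> carrier R" "d \<in> D"
  shows "frac r c = frac s d \<longleftrightarrow> r \<otimes> d = s \<otimes> c"
  using eq_equiv_class_iff[OF equiv_frac_rel, of "(r, c)" "(s, d)"] assms
  by (simp add: frac_def frac_class_def frac_rel_iff frac_pairs_def)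

lemma frac_same_eq_iff:
  assumes "r \<in> carrier R" "s \<in> carrier R" "c \<in> D"
  shows "frac r c = frac s c \<longleftrightarrow> r = s"
  using frac_eq_iff[OF assms(1,3,2,3)] cancel[OF assms(3,1,2)] by auto

lemma frac_mult:
  assumes "r \<in> carrier R" "c \<in> D" "s \<in> carrier R" "d \<in> D"
  shows "frac r c \<otimes>\<^bsub>Q\<^esub> frac s d = frac (r \<otimes> s) (c \<otimes> d)"
proof -
  have "congruent2 (frac_rel R) (frac_rel R) (\<lambda>p q. frac_class R (pair_mult R p q))"
    unfolding frac_class_def by (rule congruent2I', rule equiv_class_eq[OF equiv_frac_rel pair_mult_cong])
  from UN_equiv_class2[OF equiv_frac_rel equiv_frac_rel this, of "(r, c)" "(s, d)"] assms
  show ?thesis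
    by (simp add: Q_def central_quotient_def frac_def frac_class_def[of _ "(r, c)"] frac_class_def[of _ "(s, d)"]
      frac_pairs_def pair_mult_def)
qed

lemma frac_add:
  assumes "r \<in> carrier R" "c \<in> D" "s \<in> carrier R" "d \<in> D"
  shows "frac r c \<oplus>\<^bsub>Q\<^esub> frac s d = frac (r \<otimes> d \<oplus> s \<otimes> c) (c \<otimes> d)"
proof -
  have "congruent2 (frac_rel R) (frac_rel R) (\<lambda>p q. frac_class R (pair_add R p q))"
    unfolding frac_class_def by (rule congruent2I', rule equiv_class_eq[OF equiv_frac_rel pair_add_cong])
  from UN_equiv_class2[OF equiv_frac_rel equiv_frac_rel this, of "(r, c)" "(s, d)"] assms
  show ?thesis
    by (simp add: Q_def central_quotient_def frac_def frac_class_def[of _ "(r, c)"] frac_class_def[of _ "(s, d)"]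
      frac_pairs_def pair_add_def)
qed

lemma frac_cancel:
  assumes "r \<in> carrier R" "c \<in> D" "d \<in> D"
  shows "frac (r \<otimes> d) (c \<otimes> d) = frac r c"
proof -
  have Z: "c \<in> Z" "d \<in> Z" using assms by auto
  note C = Z[THEN laws(2)]
  have "(r \<otimes> d) \<otimes> c = r \<otimes> (c \<otimes> d)"
    using scalar[OF Z(2) assms(1) C(1)] by simp
  then show ?thesis
    using assms C D_mult[OF assms(2,3)] by (simp add: frac_eq_iff na_m_closed)
qed

lemma frac_zero: "c \<in> D \<Longrightarrow> \<zero>\<^bsub>Q\<^esub> = frac \<zero> c"
proof -
  assume c: "c \<in> D"
  have "frac_class R (\<zero>, d) = frac \<zero> c" if "d \<in> D" for d
    using frac_eq_iff[OF zero_closed that zero_closed c] D_carrier[OF c] D_carrier[OF that]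
    by (simp add: frac_def)
  then have "(\<Union>d\<in>D. frac_class R (\<zero>, d)) = (\<Union>d\<in>D. frac \<zero> c)" by (rule SUP_cong[OF refl])
  also have "\<dots> = frac \<zero> c" using c by auto
  finally show ?thesis by (simp add: Q_def central_quotient_def)
qed

lemma frac_one: "c \<in> D \<Longrightarrow> \<one>\<^bsub>Q\<^esub> = frac c c"
proof -
  assume c: "c \<in> D"
  have "frac_class R (d, d) = frac c c" if "d \<in> D" for d
    using frac_eq_iff[OF D_carrier[OF that] that D_carrier[OF c] c] laws(6)[of d c] that D_carrier[OF c]
    by (simp add: frac_def)
  then have "(\<Union>d\<in>D. frac_class R (d, d)) = (\<Union>d\<in>D. frac c c)" by (rule SUP_cong[OF refl])
  also have "\<dots> = frac c c" using c by auto
  finally show ?thesis by (simp add: Q_def central_quotient_def)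
qed

lemma carrier_Q: "X \<in> carrier Q \<longleftrightarrow> (\<exists>r\<in>carrier R. \<exists>c\<in>D. X = frac r c)"
  by (auto simp: Q_def central_quotient_def quotient_def frac_pairs_def frac_def frac_class_def)

lemma common_denominator:
  assumes "X \<in> carrier Q" "Y \<in> carrier Q" "W \<in> carrier Q"
  obtains r s t c where "r \<in> carrier R" "s \<in> carrier R" "t \<in> carrier R" "c \<in> D"
    "X = frac r c" "Y = frac s c" "W = frac t c"
proof -
  obtain r a where r: "r \<in> carrier R" "a \<in> D" "X = frac r a"
    using assms(1) unfolding carrier_Q by blast
  obtain s b where s: "s \<in> carrier R" "b \<in> D" "Y = frac s b"
    using assms(2) unfolding carrier_Q by blast
  obtain t c where t: "t \<in> carrier R" "c \<in> D" "W = frac t c"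
    using assms(3) unfolding carrier_Q by blast
  have Z: "a \<in> Z" "b \<in> Z" "c \<in> Z" using r(2) s(2) t(2) by simp_all
  note C = Z[THEN laws(2)]
  have "b \<otimes> (a \<otimes> c) = a \<otimes> (b \<otimes> c)" "c \<otimes> (a \<otimes> b) = a \<otimes> (b \<otimes> c)"
    using laws(8)[OF Z(1) C(2) C(3)] laws(8)[OF Z(1) C(3) C(2)] laws(6)[OF Z(3) C(2)] by simp_all
  then have "X = frac (r \<otimes> (b \<otimes> c)) (a \<otimes> (b \<otimes> c))" "Y = frac (s \<otimes> (a \<otimes> c)) (a \<otimes> (b \<otimes> c))"
    "W = frac (t \<otimes> (a \<otimes> b)) (a \<otimes> (b \<otimes> c))"
    using frac_cancel[OF r(1,2) D_mult[OF s(2) t(2)]] frac_cancel[OF s(1,2) D_mult[OF r(2) t(2)]]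
      frac_cancel[OF t(1,2) D_mult[OF r(2) s(2)]] r(3) s(3) t(3) by simp_all
  then show thesis
    by (rule that[rotated 4]) (intro na_m_closed r s t C D_mult)+
qed

lemma frac_add_common:
  assumes "r \<in> carrier R" "s \<in> carrier R" "c \<in> D"
  shows "frac r c \<oplus>\<^bsub>Q\<^esub> frac s c = frac (r \<oplus> s) c"
  using assms D_carrier[OF assms(3)] frac_cancel[of "r \<oplus> s" c c] by (simp add: frac_add na_l_distr)

lemma frac_closed: "r \<in> carrier R \<Longrightarrow> c \<in> D \<Longrightarrow> frac r c \<in> carrier Q"
  unfolding carrier_Q by blast

lemma abelian_group_Q: "abelian_group Q"
proof (rule abelian_groupI)
  fix X Y W assume X: "X \<in> carrier Q" and Y: "Y \<in> carrier Q" and W: "W \<in> carrier Q"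
  obtain r s t c where f: "r \<in> carrier R" "s \<in> carrier R" "t \<in> carrier R" "c \<in> D"
    "X = frac r c" "Y = frac s c" "W = frac t c" using common_denominator[OF X Y W] .
  show "X \<oplus>\<^bsub>Q\<^esub> Y \<oplus>\<^bsub>Q\<^esub> W = X \<oplus>\<^bsub>Q\<^esub> (Y \<oplus>\<^bsub>Q\<^esub> W)"
    using f by (simp add: frac_add_common a_assoc)
next
  fix X Y assume X: "X \<in> carrier Q" and Y: "Y \<in> carrier Q"
  obtain r s t c where f: "r \<in> carrier R" "s \<in> carrier R" "t \<in> carrier R" "c \<in> D"
    "X = frac r c" "Y = frac s c" using common_denominator[OF X Y Y] .
  show "X \<oplus>\<^bsub>Q\<^esub> Y \<in> carrier Q" using f by (simp add: frac_add_common frac_closed)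
  show "X \<oplus>\<^bsub>Q\<^esub> Y = Y \<oplus>\<^bsub>Q\<^esub> X" using f by (simp add: frac_add_common a_comm)
next
  show "\<zero>\<^bsub>Q\<^esub> \<in> carrier Q" 
  proof -
    obtain c where "c \<in> D" using center_nonzero by blast
    then show ?thesis using frac_zero frac_closed by simp
  qed
next
  fix X assume X: "X \<in> carrier Q"
  then obtain r c where f: "r \<in> carrier R" "c \<in> D" "X = frac r c" unfolding carrier_Q by blast
  show "\<zero>\<^bsub>Q\<^esub> \<oplus>\<^bsub>Q\<^esub> X = X" using f frac_zero[OF f(2)] by (simp add: frac_add_common)
  have "frac (\<ominus> r) c \<oplus>\<^bsub>Q\<^esub> X = \<zero>\<^bsub>Q\<^esub>"
    using f frac_zero[OF f(2)] by (simp add: frac_add_common l_neg)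
  then show "\<exists>Y\<in>carrier Q. Y \<oplus>\<^bsub>Q\<^esub> X = \<zero>\<^bsub>Q\<^esub>" using f frac_closed by blast
qed

interpretation Q: abelian_group Q by (rule abelian_group_Q)

text \<open>
  Over a common denominator \<open>c\<close>, the associator has denominator \<open>c * (c * c)\<close> and the expected numerator.
  Alternativity, non-associativity and the nucleus are therefore those of the original ring.
\<close>

lemma associator_Q_zero:
  assumes "r \<in> carrier R" "s \<in> carrier R" "t \<in> carrier R" "c \<in> D"
  shows "associator Q (frac r c) (frac s c) (frac t c) = \<zero>\<^bsub>Q\<^esub> \<longleftrightarrow> associator R r s t = \<zero>"
proof -
  have cD: "c \<otimes> c \<in> D" using assms by (intro D_mult)
  have ccc: "c \<otimes> (c \<otimes> c) = (c \<otimes> c) \<otimes> c" "c \<otimes> (c \<otimes> c) \<in> D"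
    using laws(6)[of c "c \<otimes> c"] assms D_carrier[OF cD] D_mult[OF _ cD, of c] by simp_all
  have "associator Q (frac r c) (frac s c) (frac t c) = \<zero>\<^bsub>Q\<^esub> \<longleftrightarrow>
    frac ((r \<otimes> s) \<otimes> t) (c \<otimes> (c \<otimes> c)) = frac (r \<otimes> (s \<otimes> t)) (c \<otimes> (c \<otimes> c))"
    unfolding associator_def using assms cD ccc by (simp add: frac_mult na_m_closed frac_closed)
  also have "\<dots> \<longleftrightarrow> (r \<otimes> s) \<otimes> t = r \<otimes> (s \<otimes> t)"
    using assms by (intro frac_same_eq_iff ccc na_m_closed)
  also have "\<dots> \<longleftrightarrow> associator R r s t = \<zero>"
    unfolding associator_def using assms by (simp add: na_m_closed)
  finally show ?thesis .
qed

lemma commutator_Q_zero: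
  assumes "r \<in> carrier R" "s \<in> carrier R" "c \<in> D"
  shows "commutator Q (frac r c) (frac s c) = \<zero>\<^bsub>Q\<^esub> \<longleftrightarrow> commutator R r s = \<zero>"
proof -
  have cD: "c \<otimes> c \<in> D" using assms by (intro D_mult)
  have "commutator Q (frac r c) (frac s c) = \<zero>\<^bsub>Q\<^esub> \<longleftrightarrow> frac (r \<otimes> s) (c \<otimes> c) = frac (s \<otimes> r) (c \<otimes> c)"
    unfolding commutator_def using assms cD by (simp add: frac_mult na_m_closed frac_closed)
  also have "\<dots> \<longleftrightarrow> r \<otimes> s = s \<otimes> r"
    using assms by (intro frac_same_eq_iff cD na_m_closed)
  also have "\<dots> \<longleftrightarrow> commutator R r s = \<zero>"
    unfolding commutator_def using assms by (simp add: na_m_closed)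
  finally show ?thesis .
qed

lemma alternative_ring_Q: "alternative_ring Q"
proof unfold_locales
  fix X Y W assume X: "X \<in> carrier Q" and Y: "Y \<in> carrier Q" and W: "W \<in> carrier Q"
  obtain r s t c where f: "r \<in> carrier R" "s \<in> carrier R" "t \<in> carrier R" "c \<in> D"
    "X = frac r c" "Y = frac s c" "W = frac t c" using common_denominator[OF X Y W] .
  have cD: "c \<otimes> c \<in> D" using f by (intro D_mult)
  show "(X \<oplus>\<^bsub>Q\<^esub> Y) \<otimes>\<^bsub>Q\<^esub> W = X \<otimes>\<^bsub>Q\<^esub> W \<oplus>\<^bsub>Q\<^esub> Y \<otimes>\<^bsub>Q\<^esub> W"
    using f cD by (simp add: frac_add_common frac_mult na_l_distr na_m_closed)
  show "W \<otimes>\<^bsub>Q\<^esub> (X \<oplus>\<^bsub>Q\<^esub> Y) = W \<otimes>\<^bsub>Q\<^esub> X \<oplus>\<^bsub>Q\<^esub> W \<otimes>\<^bsub>Q\<^esub> Y"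
    using f cD by (simp add: frac_add_common frac_mult na_r_distr na_m_closed)
next
  fix X Y assume X: "X \<in> carrier Q" and Y: "Y \<in> carrier Q"
  obtain r s t c where f: "r \<in> carrier R" "s \<in> carrier R" "t \<in> carrier R" "c \<in> D"
    "X = frac r c" "Y = frac s c" using common_denominator[OF X Y Y] .
  show "X \<otimes>\<^bsub>Q\<^esub> Y \<in> carrier Q"
    using f D_mult by (simp add: frac_mult frac_closed na_m_closed)
  show "associator Q X Y Y = \<zero>\<^bsub>Q\<^esub>" "associator Q Y Y X = \<zero>\<^bsub>Q\<^esub>"
    using f associator_Q_zero right_alternative left_alternative by simp_all
qed

lemma center_Q: "ring_center Q = {frac d c | d c. d \<in> Z \<and> c \<in> Z \<and> c \<noteq> \<zero>}"
proof -
  have "frac r c \<in> ring_center Q \<longleftrightarrow> r \<in> Z" if r: "r \<in> carrier R" and c: "c \<in> D" for r c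
  proof
    assume L: "frac r c \<in> ring_center Q"
    have "associator R r s t = \<zero>" "commutator R r s = \<zero>" if "s \<in> carrier R" "t \<in> carrier R" for s t
      using L associator_Q_zero[OF r that c] commutator_Q_zero[OF r that(1) c] frac_closed that c
      unfolding ring_center_def nucleus_def by auto
    then show "r \<in> Z" using r by (auto simp: ring_center_def nucleus_def)
  next
    assume L: "r \<in> Z"
    have "associator Q (frac r c) Y W = \<zero>\<^bsub>Q\<^esub> \<and> commutator Q (frac r c) Y = \<zero>\<^bsub>Q\<^esub>"
      if Y: "Y \<in> carrier Q" and W: "W \<in> carrier Q" for Y W
    proof -
      obtain s t u e where f: "s \<in> carrier R" "t \<in> carrier R" "u \<in> carrier R" "e \<in> D"
        "Y = frac s e" "W = frac t e" using common_denominator[OF Y W W] .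
      have e: "e \<in> Z" "e \<in> carrier R" and c': "c \<in> Z" "c \<in> carrier R" using f c laws(2) by auto
      have re: "r \<otimes> e \<in> Z" using laws(5) L e by blast
      have ce: "c \<otimes> e \<in> D" using D_mult c f by blast
      have X': "frac r c = frac (r \<otimes> e) (c \<otimes> e)"
        using frac_cancel[OF r c f(4)] by simp
      have Y': "Y = frac (s \<otimes> c) (c \<otimes> e)" "W = frac (t \<otimes> c) (c \<otimes> e)"
        using frac_cancel[OF f(1,4) c] frac_cancel[OF f(2,4) c] f(5,6) laws(6)[OF c'(1) e(2)] by simp_all
      have "associator R (r \<otimes> e) (s \<otimes> c) (t \<otimes> c) = \<zero>" "commutator R (r \<otimes> e) (s \<otimes> c) = \<zero>"
        using re f c' na_m_closed by (auto simp: ring_center_def nucleus_def)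
      then show ?thesis
        unfolding X' Y' using associator_Q_zero commutator_Q_zero f c' e r ce na_m_closed by simp
    qed
    then show "frac r c \<in> ring_center Q"
      using frac_closed[OF r c] by (auto simp: ring_center_def nucleus_def)
  qed
  then have iff: "frac r c \<in> ring_center Q \<longleftrightarrow> r \<in> Z" if "r \<in> carrier R" "c \<in> D" for r c
    using that by blast
  show ?thesis
  proof (intro equalityI subsetI)
    fix X assume X: "X \<in> ring_center Q"
    then have "X \<in> carrier Q" by (simp add: ring_center_def nucleus_def)
    then obtain r c where f: "r \<in> carrier R" "c \<in> D" "X = frac r c" unfolding carrier_Q by blast
    with X iff[OF f(1,2)] show "X \<in> {frac d c | d c. d \<in> Z \<and> c \<in> Z \<and> c \<noteq> \<zero>}" by auto
  next
    fix X assume "X \<in> {frac d c | d c. d \<in> Z \<and> c \<in> Z \<and> c \<noteq> \<zero>}"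
    then obtain d c where f: "d \<in> Z" "c \<in> D" "X = frac d c" by blast
    then show "X \<in> ring_center Q" using iff[OF laws(2)[OF f(1)] f(2)] by simp
  qed
qed

lemma domain_Q: "domain_like Q"
  unfolding domain_like_def
proof (intro ballI impI)
  fix X Y assume X: "X \<in> carrier Q" and Y: "Y \<in> carrier Q" and XY: "X \<otimes>\<^bsub>Q\<^esub> Y = \<zero>\<^bsub>Q\<^esub>"
  obtain r s t c where f: "r \<in> carrier R" "s \<in> carrier R" "t \<in> carrier R" "c \<in> D"
    "X = frac r c" "Y = frac s c" using common_denominator[OF X Y Y] .
  have cD: "c \<otimes> c \<in> D" using f by (intro D_mult)
  have "frac (r \<otimes> s) (c \<otimes> c) = frac \<zero> (c \<otimes> c)"
    using XY f frac_zero[OF cD] by (simp add: frac_mult)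
  then have "(r \<otimes> s) \<otimes> (c \<otimes> c) = \<zero>"
    using f cD D_carrier[OF cD] by (simp add: frac_eq_iff na_m_closed)
  then have "r = \<zero> \<or> s = \<zero>"
    using no_zd f cD D_carrier na_m_closed by blast
  then show "X = \<zero>\<^bsub>Q\<^esub> \<or> Y = \<zero>\<^bsub>Q\<^esub>" using f frac_zero by auto
qed

lemma not_associative_Q: "\<not> associative_ring R \<Longrightarrow> \<not> associative_ring Q"
proof -
  assume "\<not> associative_ring R"
  then obtain r s t where "r \<in> carrier R" "s \<in> carrier R" "t \<in> carrier R" "associator R r s t \<noteq> \<zero>"
    by (auto simp: associative_ring_def)
  moreover obtain c where "c \<in> D" using center_nonzero by blast
  ultimately have "associator Q (frac r c) (frac s c) (frac t c) \<noteq> \<zero>\<^bsub>Q\<^esub>"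
    "frac r c \<in> carrier Q" "frac s c \<in> carrier Q" "frac t c \<in> carrier Q"
    using associator_Q_zero[of r s t c] frac_closed[of _ c] by simp_all
  then show ?thesis unfolding associative_ring_def by blast
qed

lemma not_char_two_Q: "not_char_two R \<Longrightarrow> not_char_two Q"
proof -
  assume "not_char_two R"
  then obtain r where r: "r \<in> carrier R" "r \<oplus> r \<noteq> \<zero>" by (auto simp: not_char_two_def)
  obtain c where c: "c \<in> D" using center_nonzero by blast
  have "frac r c \<oplus>\<^bsub>Q\<^esub> frac r c \<noteq> \<zero>\<^bsub>Q\<^esub>"
    using r c frac_zero[OF c] D_carrier[OF c] no_zd[of "r \<oplus> r" c] by (auto simp: frac_add_common frac_eq_iff)
  then show ?thesis using r c frac_closed by (auto simp: not_char_two_def)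
qed

lemma central_division_Q: "central_division Q"
  unfolding central_division_def
proof (intro conjI ballI impI)
  obtain c where c: "c \<in> D" using center_nonzero by blast
  show "\<one>\<^bsub>Q\<^esub> \<in> carrier Q" using c frac_one frac_closed D_carrier by auto
next
  fix X assume "X \<in> carrier Q"
  then obtain r c where f: "r \<in> carrier R" "c \<in> D" "X = frac r c" unfolding carrier_Q by blast
  then show "X \<otimes>\<^bsub>Q\<^esub> \<one>\<^bsub>Q\<^esub> = X" "\<one>\<^bsub>Q\<^esub> \<otimes>\<^bsub>Q\<^esub> X = X"
    using frac_one[OF f(2)] frac_cancel[OF f(1,2,2)] D_carrier[OF f(2)] laws(6)[of c r]
    by (simp_all add: frac_mult)
next
  fix X assume "X \<in> ring_center Q" "X \<noteq> \<zero>\<^bsub>Q\<^esub>"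
  then obtain d c where f: "d \<in> Z" "c \<in> D" "X = frac d c" using center_Q by blast
  then have d: "d \<in> D" using \<open>X \<noteq> \<zero>\<^bsub>Q\<^esub>\<close> frac_zero by auto
  have "X \<otimes>\<^bsub>Q\<^esub> frac c d = \<one>\<^bsub>Q\<^esub>"
    using f d D_carrier laws(6)[of d c] frac_one[OF D_mult[OF f(2) d]] by (simp add: frac_mult)
  moreover have "frac c d \<in> ring_center Q" using center_Q f d by blast
  ultimately show "\<exists>Y\<in>ring_center Q. X \<otimes>\<^bsub>Q\<^esub> Y = \<one>\<^bsub>Q\<^esub>" by blast
qed

end

section \<open>The octonion algebra\<close>

text \<open>
  A norm form with an orthogonal frame of eight elements, as supplied by the structure theorem.
\<close>

locale octonion_data = alternative_ring Q for Q :: "'b ring" (structure) +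
  fixes q :: "'b \<Rightarrow> 'b" and B :: "'b set"
  assumes nontrivial: "not_char_two Q"
    and two: "x \<in> carrier Q \<Longrightarrow> x \<oplus> x = \<zero> \<Longrightarrow> x = \<zero>"
    and division: "central_division Q"
    and norm: "central_norm Q q"
    and frame: "orthogonal_frame Q q B"
    and card_frame: "card B = 8"
begin

abbreviation F where "F \<equiv> center_ring Q"
abbreviation V where "V \<equiv> self_module Q"

lemmas laws = center_lawsD[OF alternative_ring_axioms]

lemma F_ops [simp]: "carrier F = ring_center Q" "\<zero>\<^bsub>F\<^esub> = \<zero>" "\<one>\<^bsub>F\<^esub> = \<one>" "x \<oplus>\<^bsub>F\<^esub> y = x \<oplus> y" "x \<otimes>\<^bsub>F\<^esub> y = x \<otimes> y"
  by (simp_all add: center_ring_def)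

lemma V_ops [simp]: "carrier V = carrier Q" "\<zero>\<^bsub>V\<^esub> = \<zero>" "\<one>\<^bsub>V\<^esub> = \<one>" "x \<oplus>\<^bsub>V\<^esub> y = x \<oplus> y" "x \<otimes>\<^bsub>V\<^esub> y = x \<otimes> y"
  "x \<odot>\<^bsub>V\<^esub> y = x \<otimes> y"
  by (simp_all add: self_module_def)

lemma unit: "\<one> \<in> carrier Q" "x \<in> carrier Q \<Longrightarrow> \<one> \<otimes> x = x" "x \<in> carrier Q \<Longrightarrow> x \<otimes> \<one> = x"
  using division by (auto simp: central_division_def)

lemma unit_central: "\<one> \<in> ring_center Q"
  using unit by (simp add: ring_center_def nucleus_def associator_def commutator_def na_m_closed)

lemma unit_nonzero: "\<one> \<noteq> \<zero>"
proof
  assume "\<one> = \<zero>"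
  then have "x = \<zero>" if "x \<in> carrier Q" for x
    using unit(2)[OF that] zero_times(1)[OF that] by simp
  then show False using nontrivial by (auto simp: not_char_two_def)
qed

lemma abelian_group_F: "abelian_group F"
proof (rule abelian_groupI; simp)
  fix x assume x: "x \<in> ring_center Q"
  then show "\<exists>y\<in>ring_center Q. y \<oplus> x = \<zero>"
    using laws(2,3) l_neg by blast
qed (use laws(1,2,4) a_assoc a_comm in auto)

lemma field_F: "field F"
proof -
  have "cring F"
  proof (rule cringI[OF abelian_group_F])
    show "comm_monoid F"
      by (rule comm_monoidI) (simp_all add: laws unit_central unit)
  qed (simp add: laws(2) na_l_distr)
  then show ?thesis
  proof (rule cring.cring_fieldI2)
    show "\<exists>b\<in>carrier F. a \<otimes>\<^bsub>F\<^esub> b = \<one>\<^bsub>F\<^esub>" if "a \<in> carrier F" "a \<noteq> \<zero>\<^bsub>F\<^esub>" for a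
      using that division by (auto simp: central_division_def)
  qed (use unit_nonzero in auto)
qed

lemma abelian_group_V: "abelian_group V"
  by (rule abelian_groupI) (simp_all add: a_assoc a_comm a_lcomm)

lemma vectorspace_V: "vectorspace F V"
proof (rule vectorspace.intro[OF _ field_F])
  show "module F V"
    by (rule moduleI[OF domain.axioms(1)[OF field.axioms(1)[OF field_F]] abelian_group_V])
      (simp_all add: laws(2) laws(7) na_m_closed na_l_distr na_r_distr unit)
qed

lemma unital_algebra_V: "unital_algebra F V"
proof (intro unital_algebra.intro vectorspace_V nonassoc_ring.intro abelian_group_V)
  show "nonassoc_ring_axioms V"
    by unfold_locales (simp_all add: na_m_closed na_l_distr na_r_distr)
  show "unital_algebra_axioms F V"
    by unfold_locales (simp_all add: unit laws)
qed

interpretation V: vectorspace F V by (rule vectorspace_V)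

lemma minus_F: "x \<in> ring_center Q \<Longrightarrow> y \<in> ring_center Q \<Longrightarrow> x \<ominus>\<^bsub>F\<^esub> y = x \<ominus> y"
proof -
  assume x: "x \<in> ring_center Q" and y: "y \<in> ring_center Q"
  have "\<ominus>\<^bsub>F\<^esub> y = \<ominus> y"
    using abelian_group.minus_equality[OF abelian_group_F, of "\<ominus> y" y] y laws by (simp add: l_neg)
  then show ?thesis by (simp add: a_minus_def)
qed

abbreviation b where "b \<equiv> polar_in Q q"

lemma q_props:
  "x \<in> carrier Q \<Longrightarrow> q x \<in> ring_center Q"
  "x \<in> carrier Q \<Longrightarrow> q x = \<zero> \<Longrightarrow> x = \<zero>"
  "x \<in> carrier Q \<Longrightarrow> y \<in> carrier Q \<Longrightarrow> q (x \<otimes> y) = q x \<otimes> q y"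
  "c \<in> ring_center Q \<Longrightarrow> x \<in> carrier Q \<Longrightarrow> q (c \<otimes> x) = (c \<otimes> c) \<otimes> q x"
  "x \<in> carrier Q \<Longrightarrow> b x x = q x \<oplus> q x"
  "x \<in> carrier Q \<Longrightarrow> y \<in> carrier Q \<Longrightarrow> z \<in> carrier Q \<Longrightarrow> b (x \<oplus> y) z = b x z \<oplus> b y z"
  "c \<in> ring_center Q \<Longrightarrow> x \<in> carrier Q \<Longrightarrow> y \<in> carrier Q \<Longrightarrow> b (c \<otimes> x) y = c \<otimes> b x y"
  using norm unfolding central_norm_def by auto

lemma b_central: "x \<in> carrier Q \<Longrightarrow> y \<in> carrier Q \<Longrightarrow> b x y \<in> ring_center Q"
  using q_props(1) laws(3,4) by (simp add: polar_in_def a_minus_def)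

lemma b_self_zero: "x \<in> carrier Q \<Longrightarrow> b x x = \<zero> \<Longrightarrow> x = \<zero>"
  using q_props(1,2,5) two laws(2) by metis

lemma polar_form_eq: "x \<in> carrier Q \<Longrightarrow> y \<in> carrier Q \<Longrightarrow> polar_form F V q x y = b x y"
  using q_props(1) laws(3,4) minus_F
  by (simp add: polar_form_def polar_in_def) (simp add: a_minus_def)

lemma frame_props:
  "B \<subseteq> carrier Q" "finite B"
  "\<zero> \<notin> B" "f \<in> B \<Longrightarrow> g \<in> B \<Longrightarrow> f \<noteq> g \<Longrightarrow> b f g = \<zero>"
  "x \<in> carrier Q \<Longrightarrow> (\<And>f. f \<in> B \<Longrightarrow> b x f = \<zero>) \<Longrightarrow> x = \<zero>"
  using frame card_frame unfolding orthogonal_frame_def by (auto intro: card_ge_0_finite)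

lemma b_zero: "y \<in> carrier Q \<Longrightarrow> b \<zero> y = \<zero>"
  using q_props(7)[of \<zero> \<zero> y] laws(1) zero_times(1)[of "b \<zero> y"] zero_times(1)[of \<zero>]
    b_central[of \<zero> y] laws(2) by simp

text \<open>
  Pairing with a frame element reads off a coordinate, which yields independence and
  spanning of the frame.
\<close>

lemma b_lincomb:
  assumes "finite A" "A \<subseteq> B" "a \<in> A \<rightarrow> ring_center Q" "f \<in> B"
  shows "V.lincomb a A \<in> carrier Q \<and> b (V.lincomb a A) f = (if f \<in> A then a f \<otimes> b f f else \<zero>)"
  using assms(1-3)
proof (induction A rule: finite_induct)
  case empty
  then show ?case using assms(4) frame_props(1) b_zero by (auto simp: V.lincomb_def)
next
  case (insert v A)
  have in_Q: "v \<in> carrier Q" "f \<in> carrier Q" "A \<subseteq> carrier Q" and av: "a v \<in> ring_center Q"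
    using insert.prems assms(4) frame_props(1) by auto
  have IH: "V.lincomb a A \<in> carrier Q" "b (V.lincomb a A) f = (if f \<in> A then a f \<otimes> b f f else \<zero>)"
    using insert by auto
  have avQ: "a v \<in> carrier Q" using laws(2) av by blast
  have lc: "V.lincomb a (insert v A) = a v \<otimes> v \<oplus> V.lincomb a A"
    using V.lincomb_insert[of A a v] insert in_Q by auto
  have "b (V.lincomb a (insert v A)) f = a v \<otimes> b v f \<oplus> b (V.lincomb a A) f"
    unfolding lc using in_Q IH(1) av avQ by (simp add: q_props na_m_closed)
  moreover have "b v f = \<zero>" if "f \<noteq> v"
    using frame_props(4)[of v f] insert.prems assms(4) that by auto
  moreover have "a v \<otimes> b v f \<in> carrier Q"
    using avQ laws(2)[OF b_central[OF in_Q(1,2)]] by (rule na_m_closed)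
  moreover have "a f \<otimes> b f f \<in> carrier Q" if "f \<in> A"
    using that insert.prems laws(2) b_central[OF in_Q(2,2)] by (intro na_m_closed) auto
  ultimately show ?case
    unfolding IH(2) using insert.hyps(2) in_Q IH(1) avQ lc laws(2)[OF b_central]
    by (cases "f = v") (auto simp: na_m_closed)
qed

lemma frame_basis: "V.basis B"
  unfolding V.basis_def
proof (intro conjI)
  show "B \<subseteq> carrier V" using frame_props(1) by simp
  have fQ: "f \<in> carrier Q" if "f \<in> B" for f
    using frame_props(1) that by blast
  have B0: "b f f \<noteq> \<zero>" if "f \<in> B" for f
    using b_self_zero[OF fQ[OF that]] frame_props(3) that by auto
  show "V.lin_indpt B"
  proof (rule V.finite_lin_indpt2[OF frame_props(2)])
    show "B \<subseteq> carrier V" using frame_props(1) by simp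
    fix a assume a: "a \<in> B \<rightarrow> carrier F" and 0: "V.lincomb a B = \<zero>\<^bsub>V\<^esub>"
    show "\<forall>f\<in>B. a f = \<zero>\<^bsub>F\<^esub>"
    proof
      fix f assume f: "f \<in> B"
      have "a f \<otimes> b f f = \<zero>"
        using b_lincomb[OF frame_props(2) subset_refl _ f, of a] a 0 f b_zero[OF fQ[OF f]] by simp
      then show "a f = \<zero>\<^bsub>F\<^esub>"
        using domain.integral[OF field.axioms(1)[OF field_F], of "a f" "b f f"] a f B0[OF f] b_central[OF fQ[OF f] fQ[OF f]] by auto
    qed
  qed
  have "\<forall>f\<in>B. \<exists>d. d \<in> ring_center Q \<and> b f f \<otimes> d = \<one>"
    using division B0 b_central fQ unfolding central_division_def by blast
  then obtain d where d: "\<And>f. f \<in> B \<Longrightarrow> d f \<in> ring_center Q" "\<And>f. f \<in> B \<Longrightarrow> b f f \<otimes> d f = \<one>"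
    by metis
  have "x \<in> V.span B" if x: "x \<in> carrier Q" for x
  proof -
    define a where "a f = b x f \<otimes> d f" for f
    define y where "y = V.lincomb a B"
    have a: "a \<in> B \<rightarrow> ring_center Q"
      unfolding a_def using laws(5) b_central[OF x] fQ d(1) by blast
    have y: "y \<in> carrier Q" "b y f = b x f" if f: "f \<in> B" for f
    proof -
      have bxf: "b x f \<in> ring_center Q" and bff: "b f f \<in> ring_center Q"
        using b_central x fQ[OF f] by blast+
      have "a f \<otimes> b f f = b x f \<otimes> (b f f \<otimes> d f)"
        unfolding a_def using laws(7)[OF bxf laws(2)[OF d(1)[OF f]] laws(2)[OF bff]]
          laws(6)[OF d(1)[OF f] laws(2)[OF bff]] by simp
      also have "\<dots> = b x f"
        using d(2)[OF f] unit(3)[OF laws(2)[OF bxf]] by simp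
      finally show "y \<in> carrier Q" "b y f = b x f"
        using b_lincomb[OF frame_props(2) subset_refl a f] f by (simp_all add: y_def)
    qed
    have yQ: "y \<in> carrier Q"
      using y card_frame by (metis all_not_in_conv card.empty zero_neq_numeral)
    have "x \<ominus> y = \<zero>"
    proof (rule frame_props(5))
      show xy: "x \<ominus> y \<in> carrier Q" using x yQ by simp
      fix f assume f: "f \<in> B"
      have "b x f = b ((x \<ominus> y) \<oplus> y) f"
        using x yQ by (simp add: a_minus_def a_assoc l_neg)
      also have "\<dots> = b (x \<ominus> y) f \<oplus> b x f"
        using q_props(6)[OF xy yQ fQ[OF f]] y(2)[OF f] by simp
      finally show "b (x \<ominus> y) f = \<zero>"
        using add.r_cancel_one'[of "b x f" "b (x \<ominus> y) f"] laws(2) b_central x xy fQ[OF f] by blast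
    qed
    then have "x = y" using x yQ by simp
    then show ?thesis
      unfolding V.finite_span[OF frame_props(2), simplified, OF frame_props(1)] y_def using a by auto
  qed
  moreover have "V.span B \<subseteq> carrier V"
    using V.finite_span[OF frame_props(2)] frame_props(1) V.lincomb_closed by auto
  ultimately show "V.gen_set B" by auto
qed

lemma octonion_algebra_V: "octonion_algebra F V"
  unfolding octonion_algebra_def
proof (intro conjI exI[of _ q])
  show "unital_algebra F V" by (rule unital_algebra_V)
  show "V.fin_dim" unfolding V.fin_dim_def using frame_basis frame_props(2) by (auto simp: V.basis_def)
  show "V.dim = 8" using V.dim_basis[OF frame_props(2) frame_basis] card_frame by simp
  show "quadratic_form F V q"
    unfolding quadratic_form_def using laws(2) by (auto simp: q_props(1,4,6,7) polar_form_eq na_m_closed)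
  show "nondegenerate_form F V (polar_form F V q)"
    unfolding nondegenerate_form_def using b_self_zero by (auto simp: polar_form_eq)
qed (simp add: q_props)

end

theorem octonion_division_algebra_over_center:
  fixes Q :: "'b ring"
  assumes alt: "alternative_ring Q" and na: "\<not> associative_ring Q" and dom: "domain_like Q"
    and two: "not_char_two Q" and div: "central_division Q"
  shows "octonion_division_algebra (center_ring Q) (self_module Q)"
proof -
  interpret alternative_ring Q by (rule alt)
  have inv: "\<forall>x\<in>carrier Q. x \<noteq> \<zero>\<^bsub>Q\<^esub> \<longrightarrow> (\<exists>y\<in>carrier Q. x \<otimes>\<^bsub>Q\<^esub> y = \<one>\<^bsub>Q\<^esub> \<and> y \<otimes>\<^bsub>Q\<^esub> x = \<one>\<^bsub>Q\<^esub>)"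
    and "\<exists>q B. central_norm Q q \<and> orthogonal_frame Q q B \<and> card B = 8"
    using alternative_structure[OF alt] na dom two div unfolding structure_theorem_def by blast+
  then obtain q B where qB: "central_norm Q q" "orthogonal_frame Q q B" "card B = 8" by blast
  obtain w where w: "w \<in> carrier Q" "w \<oplus>\<^bsub>Q\<^esub> w \<noteq> \<zero>\<^bsub>Q\<^esub>" using two by (auto simp: not_char_two_def)
  have torsion: "x = \<zero>\<^bsub>Q\<^esub>" if x: "x \<in> carrier Q" "x \<oplus>\<^bsub>Q\<^esub> x = \<zero>\<^bsub>Q\<^esub>" for x
  proof -
    have "(w \<oplus>\<^bsub>Q\<^esub> w) \<otimes>\<^bsub>Q\<^esub> x = w \<otimes>\<^bsub>Q\<^esub> (x \<oplus>\<^bsub>Q\<^esub> x)"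
      unfolding na_l_distr[OF w(1) w(1) x(1)] na_r_distr[OF x(1) x(1) w(1)] ..
    then show ?thesis using dom w x unfolding domain_like_def by auto
  qed
  interpret octonion_data Q q B
    by (rule octonion_data.intro[OF alt octonion_data_axioms.intro[OF two torsion div qB]])
  show ?thesis
    unfolding octonion_division_algebra_def using octonion_algebra_V inv by simp
qed

theorem mainTheorem1:
  fixes R :: "('a, 'm) ring_scheme"
  assumes alternative: "alternative_ring R"
    and not_associative: "\<not> associative_ring R"
    and associators: "\<And>x y z. \<lbrakk>x \<in> carrier R; y \<in> carrier R; z \<in> carrier R;
      associator R x y z \<noteq> \<zero>\<^bsub>R\<^esub>\<rbrakk> \<Longrightarrow> \<not> zero_divisor R (associator R x y z)"
  shows "(\<forall>x\<in>carrier R. \<not> zero_divisor R x) \<and>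
    ((\<exists>x\<in>carrier R. x \<oplus>\<^bsub>R\<^esub> x \<noteq> \<zero>\<^bsub>R\<^esub>) \<longrightarrow>
      central_quotient_makes_sense R \<and>
      octonion_division_algebra (center_ring (central_quotient R)) (self_module (central_quotient R)) \<and>
      ring_center (central_quotient R) =
        {frac_class R (d, c) | d c. d \<in> ring_center R \<and> c \<in> ring_center R \<and> c \<noteq> \<zero>\<^bsub>R\<^esub>})"
proof -
  interpret alternative_ring R by (rule alternative)
  have closed: "associator R x y z \<in> carrier R" if "x \<in> carrier R" "y \<in> carrier R" "z \<in> carrier R" for x y z
    using that by (simp add: associator_def na_m_closed)
  have "regular_associators R"
    unfolding regular_associators_def
  proof (intro ballI impI)
    fix x y z u
    assume *: "x \<in> carrier R" "y \<in> carrier R" "z \<in> carrier R" "u \<in> carrier R"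
      and 0: "associator R x y z \<otimes>\<^bsub>R\<^esub> u = \<zero>\<^bsub>R\<^esub> \<or> u \<otimes>\<^bsub>R\<^esub> associator R x y z = \<zero>\<^bsub>R\<^esub>"
    show "associator R x y z = \<zero>\<^bsub>R\<^esub> \<or> u = \<zero>\<^bsub>R\<^esub>"
    proof (rule ccontr)
      assume nz: "\<not> ?thesis"
      then have "zero_divisor R (associator R x y z)"
        using 0 *(4) closed[OF *(1-3)]
        unfolding zero_divisor_def left_zero_divisor_def right_zero_divisor_def by auto
      with associators[OF *(1-3)] nz show False by blast
    qed
  qed
  with not_associative alternative_structure[OF alternative] have dom: "domain_like R"
    unfolding structure_theorem_def by blast
  then have "\<forall>x\<in>carrier R. \<not> zero_divisor R x"
    unfolding domain_like_def zero_divisor_def left_zero_divisor_def right_zero_divisor_def by blast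
  moreover have "central_quotient_makes_sense R \<and>
      octonion_division_algebra (center_ring (central_quotient R)) (self_module (central_quotient R)) \<and>
      ring_center (central_quotient R) =
        {frac_class R (d, c) | d c. d \<in> ring_center R \<and> c \<in> ring_center R \<and> c \<noteq> \<zero>\<^bsub>R\<^esub>}"
    if "\<exists>x\<in>carrier R. x \<oplus>\<^bsub>R\<^esub> x \<noteq> \<zero>\<^bsub>R\<^esub>"
  proof -
    have two: "not_char_two R" using that by (simp add: not_char_two_def)
    have "\<exists>c\<in>ring_center R. c \<noteq> \<zero>\<^bsub>R\<^esub>"
      using alternative_structure[OF alternative] not_associative dom two
      unfolding structure_theorem_def by blast
    with dom interpret central_localization R by unfold_locales
    have "octonion_division_algebra (center_ring Q) (self_module Q)"
      by (rule octonion_division_algebra_over_center[OF alternative_ring_Q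
          not_associative_Q[OF not_associative] domain_Q not_char_two_Q[OF two] central_division_Q])
    then show ?thesis
      using makes_sense center_Q unfolding Q_def frac_def by blast
  qed
  ultimately show ?thesis by blast
qed

end
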